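(* Let $\mathscr{A}$ be a set that is at most countable, and let $X\subseteq\mathscr{A}^\omega$ be a subshift over $\mathscr{A}$ that has the right feeble specification property and admits at least two shift-invariant Borel probability measures. Let $\mu$ be a shift-invariant Borel probability measure on $X$, let $G_\mu\subseteq X$ be the set of generic points for $\mu$, let $I(X)$ be the irregular set of $X$ and let $Q(X)=X\setminus I(X)$ be the quasi-regular set. Then every Borel set $B\subseteq X$ with $G_\mu\subseteq B\subseteq Q(X)$ is $\mathbf{\Pi}^0_3$-hard. In particular, such a $B$ is $\mathbf{\Pi}^0_3$-complete provided that $B$ is a $\mathbf{\Pi}^0_3$-set. Hence $G_\mu$ and $Q(X)$ are $\mathbf{\Pi}^0_3$-complete, and $I(X)$ is $\mathbf{\Sigma}^0_3$-complete.
   Context: $\omega=\{0,1,2,\ldots\}$. $\mathscr{A}$ carries the discrete topology and $\mathscr{A}^\omega$ the product topology; $\sigma$ is the shift, $\sigma(x)_n=x_{n+1}$. A subshift over $\mathscr{A}$ is a nonempty closed set $X\subseteq\mathscr{A}^\omega$ with $\sigma(X)\subseteq X$ (not necessarily compact). $\mathscr{A}^{<\omega}$ is the set of all finite blocks over $\mathscr{A}$ (including the empty word); $|w|$ is the length of $w$. A block $w=w_1\ldots w_n$ appears in $x\in\mathscr{A}^\omega$ at position $\ell\in\omega$ if $x_{\ell+i-1}=w_i$ for $1\le i\le n$. The language $\mathscr{L}(X)$ is the set of all nonempty finite blocks that appear in some $x\in X$. $[w]$ is the set of $z\in\mathscr{A}^\omega$ with $z_0=w_1,\ldots,z_{n-1}=w_n$.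 $e(w,x,N)$ is the number of positions $\ell<N$ at which $w$ appears in $x$. For blocks $u,w$ of equal length $n$, $d_H(u,w)=|\{1\le j\le n: u_j\ne w_j\}|/n$. Right feeble specification: $X$ has it if there is a nonempty set $\mathcal{G}\subseteq\mathscr{L}(X)$ such that (1) if $u,v\in\mathcal{G}$ then $uv\in\mathcal{G}$; (2) for every $\epsilon>0$ there is $N=N(\epsilon)$ such that for every $u\in\mathcal{G}$ and $v\in\mathscr{L}(X)$ with $|v|\ge N$ there are $s,v'\in\mathscr{A}^{<\omega}$ with $|v'|=|v|$, $0\le|s|\le\epsilon|v|$, $d_H(v,v')<\epsilon$ and $usv'\in\mathcal{G}$. A Borel probability measure $\mu$ on $\mathscr{A}^\omega$ is shift-invariant if $\mu(A)=\mu(\sigma^{-1}(A))$ for all Borel $A$; it is a measure on $X$ if $\mu(X)=1$. A point $x\in X$ is generic for $\mu$ if $\lim_{N\to\infty} e(w,x,N)/N=\mu([w])$ for every nonempty finite block $w$ over $\mathscr{A}$. The irregular set $I(X)$ is the set of $x\in X$ for which there is $w\in\mathscr{L}(X)$ with $\liminf_{N\to\infty} e(w,x,N)/N<\limsup_{N\to\infty} e(w,x,N)/N$. In the Polish space $X$: $\mathbf{\Sigma}^0_1$ = open sets, $\mathbf{\Pi}^0_k$ = complements of $\mathbf{\Sigma}^0_k$ sets, $\mathbf{\Sigma}^0_{k+1}$ = countable unions of $\mathbf{\Pi}^0_k$ sets. A set is $\mathbf{\Pi}^0_3$-hard if it is not $\mathbf{\Sigma}^0_3$; it is $\mathbf{\Pi}^0_3$-complete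 if it is in $\mathbf{\Pi}^0_3\setminus\mathbf{\Sigma}^0_3$, and $\mathbf{\Sigma}^0_3$-complete if it is in $\mathbf{\Sigma}^0_3\setminus\mathbf{\Pi}^0_3$. *)

theory Defs
  imports "HOL-Probability.Probability"
begin

(* The alphabet is a set A :: 'a set; A^omega consists of the sequences nat => 'a
   with all values in A, and blocks over A are the elements of lists A. *)

definition full_shift :: "'a set \<Rightarrow> (nat \<Rightarrow> 'a) topology" where
  "full_shift A = product_topology (\<lambda>_. discrete_topology A) UNIV"

definition shift :: "(nat \<Rightarrow> 'a) \<Rightarrow> nat \<Rightarrow> 'a" where
  "shift x = (\<lambda>n. x (Suc n))"

definition subshift :: "'a set \<Rightarrow> (nat \<Rightarrow> 'a) set \<Rightarrow> bool" where
  "subshift A X \<longleftrightarrow> X \<noteq> {} \<and> closedin (full_shift A) X \<and> shift ` X \<subseteq> X"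

definition appears_at :: "'a list \<Rightarrow> (nat \<Rightarrow> 'a) \<Rightarrow> nat \<Rightarrow> bool" where
  "appears_at w x l \<longleftrightarrow> (\<forall>i<length w. x (l + i) = w ! i)"

definition language :: "(nat \<Rightarrow> 'a) set \<Rightarrow> 'a list set" where
  "language X = {w. w \<noteq> [] \<and> (\<exists>x\<in>X. \<exists>l. appears_at w x l)}"

definition cylinder :: "'a set \<Rightarrow> 'a list \<Rightarrow> (nat \<Rightarrow> 'a) set" where
  "cylinder A w = {z \<in> topspace (full_shift A). \<forall>i<length w. z i = w ! i}"

definition occurrences :: "'a list \<Rightarrow> (nat \<Rightarrow> 'a) \<Rightarrow> nat \<Rightarrow> nat" where
  "occurrences w x N = card {l. l < N \<and> appears_at w x l}"

(* Only used for blocks of equal length. *)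
definition hamming_dist :: "'a list \<Rightarrow> 'a list \<Rightarrow> real" where
  "hamming_dist u w = real (card {j. j < length u \<and> u ! j \<noteq> w ! j}) / real (length u)"

definition right_feeble_specification :: "'a set \<Rightarrow> (nat \<Rightarrow> 'a) set \<Rightarrow> bool" where
  "right_feeble_specification A X \<longleftrightarrow>
    (\<exists>G. G \<noteq> {} \<and> G \<subseteq> language X \<and>
      (\<forall>u\<in>G. \<forall>v\<in>G. u @ v \<in> G) \<and>
      (\<forall>\<epsilon>::real. \<epsilon> > 0 \<longrightarrow>
        (\<exists>N::nat. \<forall>u\<in>G. \<forall>v\<in>language X. length v \<ge> N \<longrightarrow>
          (\<exists>s\<in>lists A. \<exists>v'\<in>lists A.
            length v' = length v \<and> real (length s) \<le> \<epsilon> * real (length v) \<and>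
            hamming_dist v v' < \<epsilon> \<and> u @ s @ v' \<in> G))))"

definition borel_of :: "'b topology \<Rightarrow> 'b measure" where
  "borel_of T = sigma (topspace T) {U. openin T U}"

(* M is a shift-invariant Borel probability measure on A^omega with M(X) = 1. *)
definition invariant_prob_on :: "'a set \<Rightarrow> (nat \<Rightarrow> 'a) set \<Rightarrow> (nat \<Rightarrow> 'a) measure \<Rightarrow> bool" where
  "invariant_prob_on A X M \<longleftrightarrow>
    prob_space M \<and> sets M = sets (borel_of (full_shift A)) \<and>
    (\<forall>B\<in>sets M. emeasure M B = emeasure M (shift -` B \<inter> space M)) \<and>
    emeasure M X = 1"

definition generic_points ::
  "'a set \<Rightarrow> (nat \<Rightarrow> 'a) set \<Rightarrow> (nat \<Rightarrow> 'a) measure \<Rightarrow> (nat \<Rightarrow> 'a) set" where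
  "generic_points A X M =
    {x\<in>X. \<forall>w\<in>lists A. w \<noteq> [] \<longrightarrow>
      (\<lambda>N. real (occurrences w x N) / real N) \<longlonglongrightarrow> measure M (cylinder A w)}"

(* The frequencies are cast to ereal because liminf and limsup need a complete lattice. *)
definition irregular_set :: "(nat \<Rightarrow> 'a) set \<Rightarrow> (nat \<Rightarrow> 'a) set" where
  "irregular_set X =
    {x\<in>X. \<exists>w\<in>language X.
      liminf (\<lambda>N. ereal (real (occurrences w x N) / real N))
        < limsup (\<lambda>N. ereal (real (occurrences w x N) / real N))}"

definition quasi_regular_set :: "(nat \<Rightarrow> 'a) set \<Rightarrow> (nat \<Rightarrow> 'a) set" where
  "quasi_regular_set X = X - irregular_set X"

(* The finite levels Sigma^0_k and Pi^0_k of the Borel hierarchy, for k >= 1;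
   the value at k = 0 is a dummy. *)
fun borel_Sigma :: "'b topology \<Rightarrow> nat \<Rightarrow> 'b set set" where
  "borel_Sigma T 0 = {}"
| "borel_Sigma T (Suc 0) = {U. openin T U}"
| "borel_Sigma T (Suc (Suc k)) =
    {\<Union>F | F. countable F \<and> F \<subseteq> (\<lambda>S. topspace T - S) ` borel_Sigma T (Suc k)}"

definition borel_Pi :: "'b topology \<Rightarrow> nat \<Rightarrow> 'b set set" where
  "borel_Pi T k = (\<lambda>S. topspace T - S) ` borel_Sigma T k"

definition Pi03_hard :: "'b topology \<Rightarrow> 'b set \<Rightarrow> bool" where
  "Pi03_hard T B \<longleftrightarrow> B \<notin> borel_Sigma T 3"

definition Pi03_complete :: "'b topology \<Rightarrow> 'b set \<Rightarrow> bool" where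
  "Pi03_complete T B \<longleftrightarrow> B \<in> borel_Pi T 3 - borel_Sigma T 3"

definition Sigma03_complete :: "'b topology \<Rightarrow> 'b set \<Rightarrow> bool" where
  "Sigma03_complete T B \<longleftrightarrow> B \<in> borel_Sigma T 3 - borel_Pi T 3"

end

theory Submission imports Defs begin

text \<open>
  The sequences \<open>\<alpha> \<in> \<omega>\<^sup>\<omega>\<close> tending to infinity do not form a \<open>\<Sigma>\<^sup>0\<^sub>3\<close> set.  Let \<open>\<nu> \<noteq> \<mu>\<close> be a second
  invariant measure.  By right feeble specification one writes, in stage \<open>k\<close>, a long word that is
  statistically close to \<open>\<mu>\<close>, followed by a word close to \<open>\<nu>\<close> whose relative length is about
  \<open>1 / \<alpha> k\<close>.  The point of \<open>X\<close> obtained in the limit depends continuously on \<open>\<alpha>\<close>.  It is generic for \<open>\<mu>\<close>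
  if \<open>\<alpha>\<close> tends to infinity, and otherwise the frequencies of a block distinguishing \<open>\<mu>\<close> from \<open>\<nu>\<close>
  oscillate.  So any \<open>\<Sigma>\<^sup>0\<^sub>3\<close> set between \<open>G\<^sub>\<mu>\<close> and \<open>Q(X)\<close> would pull back to an impossible one.
\<close>

section \<open>Topology of the full shift\<close>

text \<open>Three points shape the construction. The alphabet may be infinite, so a measure is
  approximated through finitely many blocks that carry almost all of its mass, and each stage
  controls only finitely many test blocks; every block is tested from some stage on. Feeble
  specification returns the requested blocks altered and separated by gaps. All estimates therefore
  concern counts of occurrences, with an error that is a small multiple of the length plus a
  constant \<open>R k\<close>. That constant is uniform in the word already written and in the
  length requested, so it is known before any point is built, and stage \<open>k\<close> can be made
  long enough to swamp both \<open>R k\<close> and \<open>R (Suc k)\<close>. Finally, divergence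
  must follow from the mere failure of \<alpha> to tend to infinity. Each \<mu>-part dwarfs
  everything before it, so whatever \<alpha> is, the frequencies at the ends of the \<mu>-parts tend
  to those of \<mu>. The only possible limit is thus known, and infinitely many \<nu>-parts with a
  share bounded below refute it.\<close>

lemma topspace_full_shift: "topspace (full_shift A) = {x. \<forall>i. x i \<in> A}"
  by (auto simp: full_shift_def PiE_def Pi_def)

text \<open>A basic open set constrains finitely many coordinates, and discreteness allows each of
  them to be pinned to one letter. All later topology is argued with prefixes through this
  form.\<close>

lemma openin_full_shift_iff:
  "openin (full_shift A) S \<longleftrightarrow> S \<subseteq> topspace (full_shift A) \<and>
     (\<forall>x\<in>S. \<exists>n. \<forall>y\<in>topspace (full_shift A). (\<forall>i<n. y i = x i) \<longrightarrow> y \<in> S)"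
  (is "_ \<longleftrightarrow> _ \<and> ?local")
proof
  assume S: "openin (full_shift A) S"
  have ?local
  proof
    fix x assume "x \<in> S"
    with S obtain U where U: "finite {i. U i \<noteq> A}" "x \<in> PiE UNIV U" "PiE UNIV U \<subseteq> S"
      unfolding full_shift_def openin_product_topology_alt by auto
    obtain n where n: "\<And>i. U i \<noteq> A \<Longrightarrow> i < n"
      using U(1) unfolding finite_nat_iff_bounded by auto
    have "y \<in> S" if "y \<in> topspace (full_shift A)" "\<forall>i<n. y i = x i" for y
    proof -
      have "y i \<in> U i" for i
        using that n[of i] U(2) by (cases "U i = A") (auto simp: topspace_full_shift PiE_def)
      with U(3) show ?thesis by (auto simp: PiE_def)
    qed
    then show "\<exists>n. \<forall>y\<in>topspace (full_shift A). (\<forall>i<n. y i = x i) \<longrightarrow> y \<in> S" by blast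
  qed
  with S show "S \<subseteq> topspace (full_shift A) \<and> ?local"
    using openin_subset by blast
next
  assume *: "S \<subseteq> topspace (full_shift A) \<and> ?local"
  show "openin (full_shift A) S"
    unfolding full_shift_def openin_product_topology_alt
  proof
    fix x assume x: "x \<in> S"
    with * obtain n where n: "\<And>y. y\<in>topspace (full_shift A) \<Longrightarrow> (\<forall>i<n. y i = x i) \<Longrightarrow> y \<in> S"
      by blast
    have xA: "x i \<in> A" for i using x * by (auto simp: topspace_full_shift)
    let ?U = "\<lambda>i. if i < n then {x i} else A"
    have "finite {i. ?U i \<noteq> A}" by (rule finite_subset[of _ "{..<n}"]) (auto split: if_splits)
    moreover have "\<forall>i. openin (discrete_topology A) (?U i)" using xA by auto
    moreover have "x \<in> PiE UNIV ?U" using xA by auto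
    moreover have "PiE UNIV ?U \<subseteq> S"
    proof
      fix y assume y: "y \<in> PiE UNIV ?U"
      then have yi: "y i \<in> ?U i" for i by (auto simp: PiE_def Pi_def)
      have "y i \<in> A" for i using yi[of i] xA by (auto split: if_splits)
      moreover have "y i = x i" if "i < n" for i using yi[of i] that by auto
      ultimately show "y \<in> S" using n by (auto simp: topspace_full_shift)
    qed
    ultimately show "\<exists>U. finite {i \<in> UNIV. U i \<noteq> topspace (discrete_topology A)} \<and>
        (\<forall>i\<in>UNIV. openin (discrete_topology A) (U i)) \<and> x \<in> PiE UNIV U \<and> PiE UNIV U \<subseteq> S"
      by (intro exI[of _ ?U]) simp
  qed
qed

lemma topspace_subtopology_subset:
  "X \<subseteq> topspace T \<Longrightarrow> topspace (subtopology T X) = X"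
  by auto

lemma subshift_subset: "subshift A X \<Longrightarrow> X \<subseteq> topspace (full_shift A)"
  by (simp add: subshift_def closedin_subset)

lemma openin_subshift_iff:
  assumes "X \<subseteq> topspace (full_shift A)"
  shows "openin (subtopology (full_shift A) X) S \<longleftrightarrow> S \<subseteq> X \<and>
     (\<forall>x\<in>S. \<exists>n. \<forall>y\<in>X. (\<forall>i<n. y i = x i) \<longrightarrow> y \<in> S)"
    (is "_ \<longleftrightarrow> _ \<and> ?local")
proof
  assume "openin (subtopology (full_shift A) X) S"
  then obtain U where U: "openin (full_shift A) U" "S = U \<inter> X"
    by (auto simp: openin_subtopology)
  have ?local
  proof
    fix x assume "x \<in> S"
    then have "x \<in> U" using U by simp
    then obtain n where n: "\<forall>y\<in>topspace (full_shift A). (\<forall>i<n. y i = x i) \<longrightarrow> y \<in> U"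
      using U(1) unfolding openin_full_shift_iff by blast
    have "y \<in> S" if "y \<in> X" "\<forall>i<n. y i = x i" for y
      using n that U(2) assms by auto
    then show "\<exists>n. \<forall>y\<in>X. (\<forall>i<n. y i = x i) \<longrightarrow> y \<in> S" by blast
  qed
  with U show "S \<subseteq> X \<and> ?local" by blast
next
  assume *: "S \<subseteq> X \<and> ?local"
  then obtain n where n: "\<And>x y. x \<in> S \<Longrightarrow> y \<in> X \<Longrightarrow> \<forall>i<n x. y i = x i \<Longrightarrow> y \<in> S"
    by metis
  \<comment> \<open>The union of the prefix neighbourhoods of the points of \<open>S\<close>, taken
    in the full shift: an open set with trace \<open>S\<close> on \<open>X\<close>.\<close>
  let ?U = "{y \<in> topspace (full_shift A). \<exists>x\<in>S. \<forall>i<n x. y i = x i}"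
  have "openin (full_shift A) ?U"
    unfolding openin_full_shift_iff
  proof (intro conjI ballI)
    fix y assume "y \<in> ?U"
    then obtain x where "x \<in> S" "\<forall>i<n x. y i = x i" by auto
    then show "\<exists>m. \<forall>z\<in>topspace (full_shift A). (\<forall>i<m. z i = y i) \<longrightarrow> z \<in> ?U"
      by (intro exI[of _ "n x"]) auto
  qed auto
  moreover have "S = ?U \<inter> X"
  proof
    show "S \<subseteq> ?U \<inter> X" using * assms by blast
    show "?U \<inter> X \<subseteq> S" using n by blast
  qed
  ultimately show "openin (subtopology (full_shift A) X) S"
    by (auto simp: openin_subtopology)
qed

lemma openin_appears_at:
  "openin (full_shift A) {z \<in> topspace (full_shift A). appears_at w z l}"
  unfolding openin_full_shift_iff
  by (intro conjI ballI exI[of _ "l + length w"]) (auto simp: appears_at_def)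

lemma cylinder_eq: "cylinder A w = {z \<in> topspace (full_shift A). appears_at w z 0}"
  by (auto simp: cylinder_def appears_at_def)

text \<open>Shifting a point of \<open>X\<close> stays in \<open>X\<close> and moves an occurrence
  one place to the left. The language is thereby tied to cylinders and to prefixes of
  points.\<close>

lemma language_appears_at_0:
  assumes "subshift A X"
  shows "v \<in> language X \<longleftrightarrow> v \<noteq> [] \<and> (\<exists>z\<in>X. appears_at v z 0)"
proof -
  have "\<exists>z\<in>X. appears_at v z 0" if "x \<in> X" "appears_at v x l" for x l
    using that
  proof (induction l arbitrary: x)
    case (Suc l)
    have "shift x \<in> X" using assms Suc.prems by (auto simp: subshift_def)
    moreover have "appears_at v (shift x) l" using Suc.prems by (auto simp: appears_at_def shift_def)
    ultimately show ?case using Suc.IH by blast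
  qed auto
  then show ?thesis by (auto simp: language_def)
qed

lemma language_in_lists: "subshift A X \<Longrightarrow> v \<in> language X \<Longrightarrow> v \<in> lists A"
proof -
  assume X: "subshift A X" and "v \<in> language X"
  then obtain z where z: "z \<in> X" "appears_at v z 0" by (auto simp: language_appears_at_0)
  then have "z i \<in> A" for i using subshift_subset[OF X] by (auto simp: topspace_full_shift)
  then have "v ! i \<in> A" if "i < length v" for i
    using z(2) that unfolding appears_at_def by (metis add_0)
  then show "v \<in> lists A" by (auto simp: in_set_conv_nth)
qed

text \<open>This is where closedness of \<open>X\<close> enters: a point outside \<open>X\<close>
  has a prefix shared by no point of \<open>X\<close>. It places the limit of the glued words in
  \<open>X\<close>.\<close>

lemma subshift_mem_if_prefixes:
  assumes X: "subshift A X" and pre: "\<And>n. map x [0..<Suc n] \<in> language X"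
  shows "x \<in> X"
proof (rule ccontr)
  assume "x \<notin> X"
  have "x n \<in> A" for n
    using language_in_lists[OF X pre[of n]] by auto
  then have x: "x \<in> topspace (full_shift A) - X" using \<open>x \<notin> X\<close> by (auto simp: topspace_full_shift)
  have "openin (full_shift A) (topspace (full_shift A) - X)"
    using X by (auto simp: subshift_def)
  then obtain n where n: "\<forall>y\<in>topspace (full_shift A). (\<forall>i<n. y i = x i) \<longrightarrow> y \<in> topspace (full_shift A) - X"
    using x unfolding openin_full_shift_iff by blast
  obtain z where z: "z \<in> X" "appears_at (map x [0..<Suc n]) z 0"
    using pre[of n] X by (auto simp: language_appears_at_0)
  have "z i = x i" if "i < n" for i
  proof -
    have "z (0 + i) = map x [0..<Suc n] ! i"
      using z(2) that unfolding appears_at_def by simp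
    then show ?thesis using that by (simp add: nth_append del: upt_Suc)
  qed
  then show False using n z(1) subshift_subset[OF X] by blast
qed

section \<open>The third level of the Borel hierarchy\<close>

lemma borel_Sigma_2E:
  assumes "S \<in> borel_Sigma T (Suc (Suc 0))"
  obtains U :: "nat \<Rightarrow> 'b set" where "\<And>n. openin T (U n)" "S = (\<Union>n. topspace T - U n)"
proof -
  obtain F where F: "countable F" "F \<subseteq> (\<lambda>S. topspace T - S) ` {U. openin T U}" "S = \<Union>F"
    using assms by auto
  \<comment> \<open>\<open>F\<close> may be empty, whereas \<open>from_nat_into\<close> enumerates
    only nonempty sets. Adding the closed set \<open>{}\<close> leaves the union unchanged.\<close>
  let ?F = "insert {} F"
  have "\<exists>U. openin T U \<and> from_nat_into ?F n = topspace T - U" for n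
  proof -
    have "from_nat_into ?F n \<in> ?F" by (rule from_nat_into) simp
    moreover have "\<exists>U. openin T U \<and> {} = topspace T - U"
      by (intro exI[of _ "topspace T"]) simp
    ultimately show ?thesis using F(2) by blast
  qed
  then obtain U where U: "\<And>n. openin T (U n)" "\<And>n. from_nat_into ?F n = topspace T - U n" by metis
  have "S = \<Union>(range (from_nat_into ?F))" using F by (subst range_from_nat_into) auto
  also have "\<dots> = (\<Union>n. topspace T - U n)" using U by simp
  finally show thesis using that U by blast
qed

lemma borel_Sigma_3E:
  assumes "B \<in> borel_Sigma T 3"
  obtains U :: "nat \<Rightarrow> nat \<Rightarrow> 'b set"
  where "\<And>n m. openin T (U n m)" "B = (\<Union>n. topspace T \<inter> (\<Inter>m. U n m))"
proof -
  obtain F where F: "countable F" "F \<subseteq> (\<lambda>S. topspace T - S) ` borel_Sigma T (Suc (Suc 0))" "B = \<Union>F"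
    using assms by (auto simp: numeral_3_eq_3)
  let ?F = "insert {} F"
  have "\<exists>U :: nat \<Rightarrow> 'b set. (\<forall>m. openin T (U m)) \<and> from_nat_into ?F n = topspace T \<inter> (\<Inter>m. U m)" for n
  proof -
    have "from_nat_into ?F n \<in> ?F" by (rule from_nat_into) simp
    then consider "from_nat_into ?F n = {}"
      | S where "S \<in> borel_Sigma T (Suc (Suc 0))" "from_nat_into ?F n = topspace T - S"
      using F(2) by blast
    then show ?thesis
    proof cases
      case 1
      then show ?thesis by (intro exI[of _ "\<lambda>_. {}"]) auto
    next
      case 2
      obtain U :: "nat \<Rightarrow> 'b set" where "\<And>n. openin T (U n)" "S = (\<Union>n. topspace T - U n)"
        using borel_Sigma_2E[OF 2(1)] by blast
      then show ?thesis using 2(2) by (intro exI[of _ U]) auto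
    qed
  qed
  then obtain U :: "nat \<Rightarrow> nat \<Rightarrow> 'b set" where U: "\<And>n m. openin T (U n m)"
      "\<And>n. from_nat_into ?F n = topspace T \<inter> (\<Inter>m. U n m)" by metis
  have "B = \<Union>(range (from_nat_into ?F))" using F by (subst range_from_nat_into) auto
  also have "\<dots> = (\<Union>n. topspace T \<inter> (\<Inter>m. U n m))" using U by simp
  finally show thesis using that U by blast
qed

text \<open>Tailored to conditions of the shape "for each test there is a threshold from which a
  closed condition holds", which is how limits of frequencies are written below.\<close>

lemma borel_Pi_3I:
  fixes C :: "'i \<Rightarrow> nat \<Rightarrow> 'b set"
  assumes "countable I" "\<And>i n. i \<in> I \<Longrightarrow> closedin T (C i n)"
    and B: "B = {x \<in> topspace T. \<forall>i\<in>I. \<exists>n. x \<in> C i n}"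
  shows "B \<in> borel_Pi T 3"
proof -
  have two: "(\<Union>n. C i n) \<in> borel_Sigma T (Suc (Suc 0))" if "i \<in> I" for i
  proof -
    have "C i n = topspace T - (topspace T - C i n)" for n
      using assms(2)[OF that, of n] closedin_subset by blast
    moreover have "openin T (topspace T - C i n)" for n
      using assms(2)[OF that] by blast
    ultimately have "range (C i) \<subseteq> (\<lambda>S. topspace T - S) ` {U. openin T U}" by blast
    then show ?thesis by (auto intro!: exI[of _ "range (C i)"])
  qed
  let ?F = "(\<lambda>i. topspace T - (\<Union>n. C i n)) ` I"
  have "\<Union>?F \<in> borel_Sigma T (Suc (Suc (Suc 0)))"
    using assms(1) two unfolding borel_Sigma.simps(3)[of T "Suc 0"] by blast
  moreover have "B = topspace T - \<Union>?F" using B by auto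
  ultimately show ?thesis unfolding borel_Pi_def numeral_3_eq_3 by blast
qed

section \<open>A set of integer sequences that is not a countable union of G-delta sets\<close>

text \<open>Approximation \<open>m\<close> is frozen below \<open>k m\<close>, and strict growth
  gives \<open>i < k (Suc i)\<close>, so coordinate \<open>i\<close> can be read off approximation
  \<open>Suc i\<close>. All three limit constructions of the proof use this diagonal.\<close>

lemma prefix_limit:
  fixes \<beta> :: "nat \<Rightarrow> nat \<Rightarrow> 'b" and k :: "nat \<Rightarrow> nat"
  assumes agree: "\<And>m i. i < k m \<Longrightarrow> \<beta> (Suc m) i = \<beta> m i" and k: "\<And>m. k m < k (Suc m)"
    and i: "i < k m"
  shows "\<beta> (Suc i) i = \<beta> m i"
proof -
  have mono: "strict_mono k" using k by (simp add: strict_mono_Suc_iff)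
  have eq: "\<beta> m' i = \<beta> m i" if "m \<le> m'" "i < k m" for m m' i
    using that
  proof (induction m' rule: dec_induct)
    case (step j)
    then have "i < k j" using strict_mono_leD[OF mono, of m j] by simp
    then show ?case using step agree by simp
  qed simp
  have "i < k (Suc i)" using strict_mono_imp_increasing[OF mono, of "Suc i"] by simp
  then show ?thesis
    using eq[of m "Suc i" i] eq[of "Suc i" m i] i by (cases "m \<le> Suc i") auto
qed

lemma strict_mono_between:
  fixes q :: "nat \<Rightarrow> nat"
  assumes mono: "strict_mono q" and "q n \<le> i"
  obtains m where "m \<ge> n" "q m \<le> i" "i < q (Suc m)"
proof -
  have ex: "\<exists>m. i < q m" using strict_mono_imp_increasing[OF mono, of "Suc i"] by (intro exI[of _ "Suc i"]) simp
  define m where "m = (LEAST m. i < q m)"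
  have m: "i < q m" unfolding m_def by (rule LeastI_ex[OF ex])
  have "n < m" using m assms(2) strict_mono_less[OF mono, of n m] by simp
  then obtain m' where m': "m = Suc m'" by (cases m) auto
  have "\<not> i < q m'" using m' not_less_Least[of m' "\<lambda>m. i < q m"] by (simp add: m_def[symmetric])
  then show thesis using m m' \<open>n < m\<close> by (intro that[of m']) auto
qed

text \<open>Sequences tending to infinity are not a countable union of \<open>G\<^sub>\<delta>\<close> sets.  Given such a union
  inside this set, a decreasing sequence of conditions ``extend \<open>s\<close>, then stay above \<open>n\<close>''
  escapes the \<open>n\<close>-th \<open>G\<^sub>\<delta>\<close> set at step \<open>n\<close>: otherwise that \<open>G\<^sub>\<delta>\<close> set would be dense in the
  closed set given by the condition and would contain a sequence taking the value \<open>n\<close> infinitely often.\<close>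

lemma tendsto_infinity_not_Sigma3:
  fixes V :: "nat \<Rightarrow> nat \<Rightarrow> (nat \<Rightarrow> nat) set"
  assumes op: "\<And>n m \<alpha>. \<alpha> \<in> V n m \<Longrightarrow> \<exists>k. \<forall>\<beta>. (\<forall>i<k. \<beta> i = \<alpha> i) \<longrightarrow> \<beta> \<in> V n m"
  shows "(\<Union>n. \<Inter>m. V n m) \<noteq> {\<alpha>. filterlim \<alpha> at_top sequentially}"
proof
  assume eq: "(\<Union>n. \<Inter>m. V n m) = {\<alpha>. filterlim \<alpha> at_top sequentially}"
  define K where "K n s k = {\<alpha>. (\<forall>i<k. \<alpha> i = s i) \<and> (\<forall>i\<ge>k. \<alpha> i \<ge> n)}"
    for n k :: nat and s :: "nat \<Rightarrow> nat"
  have escape: "\<exists>s' k'. k' > k \<and> s' \<in> K n s k \<and> K n s' k' \<inter> (\<Inter>m. V n m) = {}" for n s k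
  proof (rule ccontr)
    assume neg: "\<not> ?thesis"
    \<comment> \<open>A state is a sequence together with the length of its frozen prefix. By
      \<open>neg\<close>, every state satisfying \<open>?P\<close> can be continued inside all the
      \<open>V n m\<close>; step \<open>m\<close> secures membership in \<open>V n m\<close> and
      plants one more value \<open>n\<close>.\<close>
    let ?P = "\<lambda>(m::nat) p. fst p \<in> K n s k \<and> snd p > k"
    let ?Q = "\<lambda>m p q. snd p < snd q \<and> (\<forall>i<snd p. fst q i = fst p i) \<and>
      (\<exists>i\<ge>snd p. i < snd q \<and> fst q i = n) \<and> (\<forall>\<gamma>. (\<forall>i<snd q. \<gamma> i = fst q i) \<longrightarrow> \<gamma> \<in> V n m)"
    have "\<exists>f. \<forall>m. ?P m (f m) \<and> ?Q m (f m) (f (Suc m))"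
    proof (rule dependent_nat_choice)
      show "\<exists>p. ?P 0 p"
        by (intro exI[of _ "(\<lambda>i. if i < k then s i else n, Suc k)"]) (auto simp: K_def)
    next
      fix p m assume p: "?P m p"
      obtain s' k' where sk: "p = (s', k')" by force
      have "K n s' k' \<inter> (\<Inter>m. V n m) \<noteq> {}" using neg p unfolding sk by auto
      then obtain \<beta> where \<beta>: "\<beta> \<in> K n s' k'" "\<beta> \<in> (\<Inter>m. V n m)" by blast
      have mem: "\<beta> \<in> K n s k"
        unfolding K_def
      proof (safe)
        fix i assume "i < k"
        then show "\<beta> i = s i" using p \<beta>(1) by (simp add: sk K_def)
      next
        fix i assume "k \<le> i"
        then show "n \<le> \<beta> i" using p \<beta>(1) by (cases "i < k'") (simp_all add: sk K_def)
      qed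
      obtain j where j: "\<forall>\<gamma>. (\<forall>i<j. \<gamma> i = \<beta> i) \<longrightarrow> \<gamma> \<in> V n m"
        using \<beta>(2) op by (metis INT_E UNIV_I)
      define l where "l = max j k'"
      let ?q = "(\<beta>(l := n), Suc l)"
      have "?P (Suc m) ?q"
        using p \<beta>(1) mem by (auto simp: sk K_def l_def)
      moreover have "?Q m p ?q"
      proof (intro conjI)
        show "snd p < snd ?q" by (simp add: sk l_def)
        show "\<forall>i<snd p. fst ?q i = fst p i" using \<beta>(1) by (auto simp: sk K_def l_def)
        show "\<exists>i\<ge>snd p. i < snd ?q \<and> fst ?q i = n" by (rule exI[of _ l]) (simp add: sk l_def)
        show "\<forall>\<gamma>. (\<forall>i<snd ?q. \<gamma> i = fst ?q i) \<longrightarrow> \<gamma> \<in> V n m"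
          using j by (auto simp: l_def)
      qed
      ultimately show "\<exists>q. ?P (Suc m) q \<and> ?Q m p q" by blast
    qed
    then obtain f where f: "\<And>m. ?P m (f m)" "\<And>m. ?Q m (f m) (f (Suc m))" by blast
    define \<gamma> where "\<gamma> i = fst (f (Suc i)) i" for i
    have \<gamma>: "\<gamma> i = fst (f m) i" if "i < snd (f m)" for m i
      unfolding \<gamma>_def
      by (rule prefix_limit[of "\<lambda>m. snd (f m)" "\<lambda>m. fst (f m)"]) (use f(2) that in auto)
    have "\<gamma> \<in> V n m" for m using f(2)[of m] \<gamma>[of _ "Suc m"] by blast
    then have "filterlim \<gamma> at_top sequentially" using eq by blast
    then obtain N where N: "\<And>i. i \<ge> N \<Longrightarrow> \<gamma> i \<ge> Suc n"
      by (auto simp: filterlim_at_top eventually_sequentially)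
    have "strict_mono (\<lambda>m. snd (f m))" using f(2) by (simp add: strict_mono_Suc_iff)
    then have "N \<le> snd (f N)" by (rule strict_mono_imp_increasing)
    moreover obtain i where "i \<ge> snd (f N)" "i < snd (f (Suc N))" "fst (f (Suc N)) i = n"
      using f(2)[of N] by blast
    ultimately show False using N[of i] \<gamma>[of i "Suc N"] by simp
  qed
  let ?Q = "\<lambda>n p q. snd p < snd q \<and> fst q \<in> K n (fst p) (snd p) \<and>
      K n (fst q) (snd q) \<inter> (\<Inter>m. V n m) = {}"
  \<comment> \<open>States need no invariant here; \<open>True\<close> fills the place that
    \<open>dependent_nat_choice\<close> has for one.\<close>
  have "\<exists>f. \<forall>m. True \<and> ?Q m (f m) (f (Suc m))"
  proof (rule dependent_nat_choice)
    fix p n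
    show "\<exists>q. True \<and> ?Q n p q" using escape[of "snd p" n "fst p"] by fastforce
  qed auto
  then obtain f where f: "\<And>n. ?Q n (f n) (f (Suc n))" by blast
  define \<gamma> where "\<gamma> i = fst (f (Suc i)) i" for i
  have \<gamma>: "\<gamma> i = fst (f m) i" if "i < snd (f m)" for m i
    unfolding \<gamma>_def
    by (rule prefix_limit[of "\<lambda>m. snd (f m)" "\<lambda>m. fst (f m)"]) (use f that in \<open>auto simp: K_def\<close>)
  have mono: "strict_mono (\<lambda>m. snd (f m))" using f by (simp add: strict_mono_Suc_iff)
  \<comment> \<open>A coordinate fixed in step \<open>m\<close> has value at least \<open>m\<close>,
    and coordinates from \<open>snd (f n)\<close> on are fixed in steps \<open>m \<ge> n\<close>. So
    \<gamma> tends to infinity and also obeys every condition chosen on the way.\<close>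
  have ge: "\<gamma> i \<ge> n" if i: "snd (f n) \<le> i" for i n
  proof -
    obtain m where m: "m \<ge> n" "snd (f m) \<le> i" "i < snd (f (Suc m))"
      using strict_mono_between[OF mono i] by blast
    then show ?thesis using f[of m] \<gamma>[of i "Suc m"] by (force simp: K_def)
  qed
  have "filterlim \<gamma> at_top sequentially"
    unfolding filterlim_at_top eventually_sequentially using ge by blast
  then obtain n where "\<gamma> \<in> (\<Inter>m. V n m)" using eq by blast
  moreover have "\<gamma> \<in> K n (fst (f (Suc n))) (snd (f (Suc n)))"
    using ge[of n] f[of n] \<gamma>[of _ "Suc n"] by (auto simp: K_def)
  ultimately show False using f[of n] by blast
qed

section \<open>Counting occurrences\<close>

text \<open>Unlike \<^const>\<open>occurrences\<close>, this only counts occurrences inside the first \<open>N\<close> letters,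
  so it depends on those letters alone.\<close>

definition inner_occ :: "'a list \<Rightarrow> (nat \<Rightarrow> 'a) \<Rightarrow> nat \<Rightarrow> nat" where
  "inner_occ w x N = card {l. l + length w \<le> N \<and> appears_at w x l}"

text \<open>Read as a sequence, \<open>(!) u\<close> has unspecified values past the end of
  \<open>u\<close>; inner counting never looks at them.\<close>

abbreviation list_occ :: "'a list \<Rightarrow> 'a list \<Rightarrow> nat" where
  "list_occ w u \<equiv> inner_occ w ((!) u) (length u)"

lemma finite_inner_occ: "finite {l. l + length w \<le> N \<and> P l}"
  by (rule finite_subset[of _ "{..N}"]) auto

lemma inner_occ_cong:
  assumes "\<And>i. i < N \<Longrightarrow> x i = y i"
  shows "inner_occ w x N = inner_occ w y N"
proof -
  have "{l. l + length w \<le> N \<and> appears_at w x l} = {l. l + length w \<le> N \<and> appears_at w y l}"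
    using assms by (auto simp: appears_at_def)
  then show ?thesis by (simp add: inner_occ_def)
qed

lemma inner_occ_mono: "N \<le> N' \<Longrightarrow> inner_occ w x N \<le> inner_occ w x N'"
  unfolding inner_occ_def by (rule card_mono[OF finite_inner_occ]) auto

text \<open>Each of the \<open>j\<close> new letters is the last letter of at most one new
  occurrence.\<close>

lemma inner_occ_add_le:
  assumes "w \<noteq> []"
  shows "inner_occ w x (N + j) \<le> inner_occ w x N + j"
proof -
  have "inner_occ w x (N + j) \<le> card ({l. l + length w \<le> N \<and> appears_at w x l} \<union>
      (\<lambda>i. N + i - length w) ` {0<..j})"
    unfolding inner_occ_def
  proof (rule card_mono)
    show "{l. l + length w \<le> N + j \<and> appears_at w x l} \<subseteq>
        {l. l + length w \<le> N \<and> appears_at w x l} \<union> (\<lambda>i. N + i - length w) ` {0<..j}"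
    proof
      fix l assume l: "l \<in> {l. l + length w \<le> N + j \<and> appears_at w x l}"
      then have "l = N + (l + length w - N) - length w" if "l + length w > N" using that by simp
      moreover have "l + length w - N \<in> {0<..j}" if "l + length w > N" using that l by auto
      ultimately show "l \<in> {l. l + length w \<le> N \<and> appears_at w x l} \<union> (\<lambda>i. N + i - length w) ` {0<..j}"
        using l by (cases "l + length w > N") (blast, simp)
    qed
  qed (simp add: finite_inner_occ)
  also have "\<dots> \<le> inner_occ w x N + card ((\<lambda>i. N + i - length w) ` {0<..j})"
    unfolding inner_occ_def by (rule card_Un_le)
  also have "\<dots> \<le> inner_occ w x N + j"
    using card_image_le[of "{0<..j}" "\<lambda>i. N + i - length w"] by simp
  finally show ?thesis .
qed

lemma inner_occ_le: "w \<noteq> [] \<Longrightarrow> inner_occ w x N \<le> N"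
  using inner_occ_add_le[of w x 0 N] by (simp add: inner_occ_def)

lemma inner_occ_shift_ge:
  assumes "w \<noteq> []"
  shows "inner_occ w x a + inner_occ w (\<lambda>i. x (a + i)) n \<le> inner_occ w x (a + n)"
proof -
  let ?S = "{l. l + length w \<le> a \<and> appears_at w x l}"
  let ?T = "{l. l + length w \<le> n \<and> appears_at w (\<lambda>i. x (a + i)) l}"
  have "inner_occ w x a + inner_occ w (\<lambda>i. x (a + i)) n = card ?S + card ((+) a ` ?T)"
    by (simp add: inner_occ_def card_image)
  also have "\<dots> = card (?S \<union> (+) a ` ?T)"
    using assms by (intro card_Un_disjoint[symmetric]) (auto simp: finite_inner_occ)
  also have "\<dots> \<le> inner_occ w x (a + n)"
    unfolding inner_occ_def by (rule card_mono[OF finite_inner_occ]) (auto simp: appears_at_def add.assoc)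
  finally show ?thesis .
qed

text \<open>Occurrences lying in neither piece straddle the cut, hence start among the
  \<open>length w\<close> positions before \<open>a\<close>.\<close>

lemma inner_occ_shift_le:
  "inner_occ w x (a + n) \<le> inner_occ w x a + inner_occ w (\<lambda>i. x (a + i)) n + length w"
proof -
  let ?S = "{l. l + length w \<le> a \<and> appears_at w x l}"
  let ?T = "{l. l + length w \<le> n \<and> appears_at w (\<lambda>i. x (a + i)) l}"
  let ?R = "{a - length w..<a}"
  have "{l. l + length w \<le> a + n \<and> appears_at w x l} \<subseteq> (?S \<union> (+) a ` ?T) \<union> ?R"
  proof
    fix l assume l: "l \<in> {l. l + length w \<le> a + n \<and> appears_at w x l}"
    show "l \<in> (?S \<union> (+) a ` ?T) \<union> ?R"
    proof (cases "a \<le> l")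
      case True
      then have "l - a \<in> ?T" using l by (auto simp: appears_at_def)
      then have "a + (l - a) \<in> (+) a ` ?T" by (rule imageI)
      then show ?thesis using True by simp
    next
      case False
      then show ?thesis using l by auto
    qed
  qed
  then have "inner_occ w x (a + n) \<le> card ((?S \<union> (+) a ` ?T) \<union> ?R)"
    unfolding inner_occ_def by (rule card_mono[rotated]) (simp add: finite_inner_occ)
  also have "\<dots> \<le> (card ?S + card ((+) a ` ?T)) + card ?R"
    by (meson add_le_mono1 card_Un_le le_trans)
  also have "\<dots> \<le> inner_occ w x a + inner_occ w (\<lambda>i. x (a + i)) n + length w"
    by (simp add: inner_occ_def card_image)
  finally show ?thesis .
qed

text \<open>An occurrence in \<open>x\<close> that is lost in \<open>y\<close> covers a mismatch,
  and for each offset inside \<open>w\<close> a mismatch determines the start of the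
  occurrence.\<close>

lemma inner_occ_mismatch:
  "inner_occ w x n \<le> inner_occ w y n + length w * card {j. j < n \<and> x j \<noteq> y j}"
proof -
  let ?J = "{j. j < n \<and> x j \<noteq> y j}"
  let ?B = "\<lambda>i. {l. l + i \<in> ?J}"
  have fin: "finite (?B i)" "card (?B i) \<le> card ?J" for i
  proof -
    have inj: "inj_on (\<lambda>l. l + i) (?B i)" and sub: "(\<lambda>l. l + i) ` ?B i \<subseteq> ?J" by auto
    show "finite (?B i)" by (rule inj_on_finite[OF inj sub]) simp
    show "card (?B i) \<le> card ?J" by (rule card_inj_on_le[OF inj sub]) simp
  qed
  have "{l. l + length w \<le> n \<and> appears_at w x l} \<subseteq>
      {l. l + length w \<le> n \<and> appears_at w y l} \<union> (\<Union>i<length w. ?B i)"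
    by (auto simp: appears_at_def)
  then have "inner_occ w x n \<le> card ({l. l + length w \<le> n \<and> appears_at w y l} \<union> (\<Union>i<length w. ?B i))"
    unfolding inner_occ_def by (rule card_mono[rotated]) (auto intro!: finite_inner_occ fin(1)[simplified])
  also have "\<dots> \<le> inner_occ w y n + card (\<Union>i<length w. ?B i)"
    unfolding inner_occ_def by (rule card_Un_le)
  also have "card (\<Union>i<length w. ?B i) \<le> (\<Sum>i<length w. card (?B i))"
    by (rule card_UN_le) simp
  also have "\<dots> \<le> (\<Sum>i<length w. card ?J)" by (rule sum_mono) (rule fin)
  finally show ?thesis by simp
qed

lemma inner_occ_le_occurrences:
  assumes "w \<noteq> []"
  shows "inner_occ w x N \<le> occurrences w x N"
proof -
  have "{l. l + length w \<le> N \<and> appears_at w x l} \<subseteq> {l. l < N \<and> appears_at w x l}"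
    using assms by (cases w) auto
  then show ?thesis unfolding inner_occ_def occurrences_def by (rule card_mono[rotated]) simp
qed

lemma occurrences_le_inner_occ: "occurrences w x N \<le> inner_occ w x N + length w"
proof -
  have "occurrences w x N \<le> card ({l. l + length w \<le> N \<and> appears_at w x l} \<union> {N - length w..<N})"
    unfolding occurrences_def by (rule card_mono) (auto simp: finite_inner_occ)
  also have "\<dots> \<le> inner_occ w x N + card {N - length w..<N}"
    unfolding inner_occ_def by (rule card_Un_le)
  finally show ?thesis by simp
qed

text \<open>The two counts differ by at most \<open>length w\<close>, which vanishes after division
  by \<open>N\<close>. Estimates on prefixes thus transfer to the frequencies in the definition of
  genericity.\<close>

lemma frequency_tendsto_iff:
  assumes "w \<noteq> []"
  shows "(\<lambda>N. real (occurrences w x N) / real N) \<longlonglongrightarrow> c \<longleftrightarrow>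
     (\<lambda>N. real (inner_occ w x N) / real N) \<longlonglongrightarrow> c"
proof (rule Lim_transform_eq)
  have *: "(\<lambda>N. real (length w) / real N) \<longlonglongrightarrow> 0" by (rule lim_const_over_n)
  show "(\<lambda>N. real (occurrences w x N) / real N - real (inner_occ w x N) / real N) \<longlonglongrightarrow> 0"
  proof (rule Lim_null_comparison[OF _ *], intro always_eventually allI)
    fix N
    have "\<bar>real (occurrences w x N) - real (inner_occ w x N)\<bar> \<le> real (length w)"
      using inner_occ_le_occurrences[OF assms, of x N] occurrences_le_inner_occ[of w x N] by linarith
    then show "norm (real (occurrences w x N) / real N - real (inner_occ w x N) / real N)
        \<le> real (length w) / real N"
      by (simp flip: diff_divide_distrib add: divide_right_mono)
  qed
qed

lemma list_occ_append_ge: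
  assumes "w \<noteq> []"
  shows "list_occ w u + list_occ w v \<le> list_occ w (u @ v)"
proof -
  have "inner_occ w ((!) (u @ v)) (length u) = list_occ w u"
    by (rule inner_occ_cong) (simp add: nth_append)
  moreover have "inner_occ w (\<lambda>i. (u @ v) ! (length u + i)) (length v) = list_occ w v"
    by (rule inner_occ_cong) (simp add: nth_append)
  ultimately show ?thesis
    using inner_occ_shift_ge[OF assms, of "(!) (u @ v)" "length u" "length v"] by simp
qed

lemma list_occ_append_le:
  "list_occ w (u @ v) \<le> list_occ w u + list_occ w v + length w"
proof -
  have "inner_occ w ((!) (u @ v)) (length u) = list_occ w u"
    by (rule inner_occ_cong) (simp add: nth_append)
  moreover have "inner_occ w (\<lambda>i. (u @ v) ! (length u + i)) (length v) = list_occ w v"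
    by (rule inner_occ_cong) (simp add: nth_append)
  ultimately show ?thesis
    using inner_occ_shift_le[of w "(!) (u @ v)" "length u" "length v"] by simp
qed

lemma list_occ_hamming:
  fixes \<epsilon> :: real
  assumes "length v = length v'" and d: "hamming_dist v v' \<le> \<epsilon>"
  shows "\<bar>real (list_occ w v) - real (list_occ w v')\<bar> \<le> length w * (\<epsilon> * length v)"
proof -
  let ?c = "card {j. j < length v \<and> v ! j \<noteq> v' ! j}"
  have c: "real ?c \<le> \<epsilon> * length v"
    using d by (cases "v = []") (auto simp: hamming_dist_def field_simps)
  have "{j. j < length v \<and> v' ! j \<noteq> v ! j} = {j. j < length v \<and> v ! j \<noteq> v' ! j}" by auto
  then have "list_occ w v \<le> list_occ w v' + length w * ?c" "list_occ w v' \<le> list_occ w v + length w * ?c"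
    using inner_occ_mismatch[of w "(!) v" "length v" "(!) v'"]
      inner_occ_mismatch[of w "(!) v'" "length v" "(!) v"] assms(1) by simp_all
  then have "\<bar>real (list_occ w v) - real (list_occ w v')\<bar> \<le> real (length w * ?c)" by linarith
  also have "\<dots> \<le> length w * (\<epsilon> * length v)" using c by (simp add: mult_left_mono)
  finally show ?thesis .
qed

section \<open>Gluing blocks\<close>

text \<open>Isolates the gluing property of the witness set, so that one fixed \<open>G\<close> can
  be carried through all constructions.\<close>

definition feeble_base :: "'a set \<Rightarrow> (nat \<Rightarrow> 'a) set \<Rightarrow> 'a list set \<Rightarrow> bool" where
  "feeble_base A X G \<longleftrightarrow> G \<noteq> {} \<and> G \<subseteq> language X \<and>
      (\<forall>\<epsilon>::real. \<epsilon> > 0 \<longrightarrow>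
        (\<exists>N::nat. \<forall>u\<in>G. \<forall>v\<in>language X. length v \<ge> N \<longrightarrow>
          (\<exists>s\<in>lists A. \<exists>v'\<in>lists A.
            length v' = length v \<and> real (length s) \<le> \<epsilon> * real (length v) \<and>
            hamming_dist v v' < \<epsilon> \<and> u @ s @ v' \<in> G)))"

lemma right_feeble_specificationD:
  "right_feeble_specification A X \<Longrightarrow> \<exists>G. feeble_base A X G"
  unfolding right_feeble_specification_def feeble_base_def by blast

text \<open>Each block of the list contributes three errors: at most \<open>\<epsilon> * n\<close>
  occurrences inside the gap, \<open>2 * length w\<close> across the two cuts around it, and
  \<open>length w * (\<epsilon> * n)\<close> from altered letters. The threshold \<open>N\<close>
  depends on neither the word \<open>u\<close> nor the list.\<close>

lemma glue_blocks:
  fixes \<epsilon> :: real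
  assumes G: "feeble_base A X G" and \<epsilon>: "\<epsilon> > 0"
  obtains N where "\<And>n u vs. n \<ge> N \<Longrightarrow> u \<in> G \<Longrightarrow> set vs \<subseteq> language X \<Longrightarrow> (\<forall>v\<in>set vs. length v = n) \<Longrightarrow>
      \<exists>t. u @ t \<in> G \<and> length vs * n \<le> length t \<and> length t \<le> (1 + \<epsilon>) * (length vs * n) \<and>
        (\<forall>w. w \<noteq> [] \<longrightarrow> \<bar>real (list_occ w (u @ t)) - list_occ w u - (\<Sum>v\<leftarrow>vs. real (list_occ w v))\<bar>
            \<le> length vs * (\<epsilon> * n + 2 * length w + length w * (\<epsilon> * n)))"
proof -
  obtain N where N: "\<forall>u\<in>G. \<forall>v\<in>language X. length v \<ge> N \<longrightarrow>
          (\<exists>s\<in>lists A. \<exists>v'\<in>lists A.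
            length v' = length v \<and> real (length s) \<le> \<epsilon> * real (length v) \<and>
            hamming_dist v v' < \<epsilon> \<and> u @ s @ v' \<in> G)"
    using G \<epsilon> unfolding feeble_base_def by blast
  show thesis
  proof (rule that[of N])
    fix n u vs
    assume "n \<ge> N" "u \<in> G" "set vs \<subseteq> language X" "\<forall>v\<in>set vs. length v = n"
    then show "\<exists>t. u @ t \<in> G \<and> length vs * n \<le> length t \<and> length t \<le> (1 + \<epsilon>) * (length vs * n) \<and>
        (\<forall>w. w \<noteq> [] \<longrightarrow> \<bar>real (list_occ w (u @ t)) - list_occ w u - (\<Sum>v\<leftarrow>vs. real (list_occ w v))\<bar>
            \<le> length vs * (\<epsilon> * n + 2 * length w + length w * (\<epsilon> * n)))"
    proof (induction vs arbitrary: u)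
      case Nil
      then show ?case by (intro exI[of _ "[]"]) simp
    next
      case (Cons v vs)
      obtain s v' where v': "length v' = n" "real (length s) \<le> \<epsilon> * n" "hamming_dist v v' < \<epsilon>"
        "u @ s @ v' \<in> G"
        using N[rule_format, of u v] Cons.prems by auto
      obtain t where t: "(u @ s @ v') @ t \<in> G" "length vs * n \<le> length t"
          "length t \<le> (1 + \<epsilon>) * (length vs * n)"
        and tw: "\<And>w. w \<noteq> [] \<Longrightarrow> \<bar>real (list_occ w ((u @ s @ v') @ t)) - list_occ w (u @ s @ v')
              - (\<Sum>v\<leftarrow>vs. real (list_occ w v))\<bar>
            \<le> length vs * (\<epsilon> * n + 2 * length w + length w * (\<epsilon> * n))"
        using Cons.IH[of "u @ s @ v'"] v'(4) Cons.prems by auto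
      have "\<bar>real (list_occ w (u @ s @ v' @ t)) - list_occ w u - (\<Sum>v\<leftarrow>v # vs. real (list_occ w v))\<bar>
            \<le> length (v # vs) * (\<epsilon> * n + 2 * length w + length w * (\<epsilon> * n))" if w: "w \<noteq> []" for w
      proof -
        have "\<bar>real (list_occ w v) - real (list_occ w v')\<bar> \<le> length w * (\<epsilon> * n)"
          using list_occ_hamming[of v v' \<epsilon> w] v' Cons.prems by simp
        moreover have "list_occ w u + list_occ w v' \<le> list_occ w (u @ s @ v')"
          using list_occ_append_ge[OF w, of u "s @ v'"] list_occ_append_ge[OF w, of s v'] by linarith
        moreover have "list_occ w (u @ s @ v') \<le> list_occ w u + length s + list_occ w v' + 2 * length w"
          using list_occ_append_le[of w u "s @ v'"] list_occ_append_le[of w s v']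
            inner_occ_le[OF w, of "(!) s" "length s"] by linarith
        ultimately have "\<bar>real (list_occ w (u @ s @ v')) - list_occ w u - real (list_occ w v)\<bar>
            \<le> \<epsilon> * n + 2 * length w + length w * (\<epsilon> * n)"
          using v'(2) by linarith
        then show ?thesis using tw[OF w] by (simp add: algebra_simps)
      qed
      then show ?case using t v'(1,2)
        by (intro exI[of _ "s @ v' @ t"]) (auto simp: algebra_simps)
    qed
  qed
qed

lemma sum_list_concat_replicate:
  assumes "finite F"
  obtains vs where "set vs \<subseteq> F" "\<And>f :: 'b \<Rightarrow> real. (\<Sum>v\<leftarrow>vs. f v) = (\<Sum>v\<in>F. real (a v) * f v)"
proof -
  obtain xs where xs: "set xs = F" "distinct xs" using finite_distinct_list[OF assms] by blast
  show thesis
  proof (rule that[of "concat (map (\<lambda>v. replicate (a v) v) xs)"])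
    show "set (concat (map (\<lambda>v. replicate (a v) v) xs)) \<subseteq> F" using xs by auto
    fix f :: "'b \<Rightarrow> real"
    have "(\<Sum>v\<leftarrow>concat (map (\<lambda>v. replicate (a v) v) xs). f v) = (\<Sum>v\<leftarrow>xs. real (a v) * f v)"
      by (induction xs) (simp_all add: sum_list_replicate)
    also have "\<dots> = (\<Sum>v\<in>F. real (a v) * f v)"
      using xs by (simp add: sum_list_distinct_conv_sum_set)
    finally show "(\<Sum>v\<leftarrow>concat (map (\<lambda>v. replicate (a v) v) xs). f v) = (\<Sum>v\<in>F. real (a v) * f v)" .
  qed
qed

section \<open>Approximating an invariant measure by blocks\<close>

lemma space_borel_of [simp]: "space (borel_of T) = topspace T"
  by (auto simp: borel_of_def space_measure_of_conv)

lemma sets_borel_of: "sets (borel_of T) = sigma_sets (topspace T) {U. openin T U}"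
  unfolding borel_of_def by (rule sets_measure_of) (auto dest: openin_subset)

lemma openin_sets_borel_of: "openin T U \<Longrightarrow> U \<in> sets (borel_of T)"
  by (simp add: sets_borel_of sigma_sets.Basic)

context
  fixes A :: "'a set" and X :: "(nat \<Rightarrow> 'a) set" and M :: "(nat \<Rightarrow> 'a) measure"
  assumes inv: "invariant_prob_on A X M"
begin

lemma inv_prob_space: "prob_space M" and
  inv_sets: "sets M = sets (borel_of (full_shift A))"
  using inv by (auto simp: invariant_prob_on_def)

lemma inv_space: "space M = topspace (full_shift A)"
  using sets_eq_imp_space_eq[OF inv_sets] by simp

lemma inv_openin_sets: "openin (full_shift A) U \<Longrightarrow> U \<in> sets M"
  by (simp add: inv_sets openin_sets_borel_of)

lemma inv_sets_appears: "{z \<in> topspace (full_shift A). appears_at w z l} \<in> sets M"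
  by (intro inv_openin_sets openin_appears_at)

lemma inv_sets_cylinder: "cylinder A w \<in> sets M"
  unfolding cylinder_eq by (rule inv_sets_appears)

text \<open>Having \<open>w\<close> at position \<open>Suc l\<close> is the preimage under the shift
  of having it at position \<open>l\<close>. This is the only way in which invariance enters the
  estimates.\<close>

lemma inv_measure_appears:
  "measure M {z \<in> topspace (full_shift A). appears_at w z l} = measure M (cylinder A w)"
proof (induction l)
  case (Suc l)
  have "{z \<in> topspace (full_shift A). appears_at w z (Suc l)} =
      shift -` {z \<in> topspace (full_shift A). appears_at w z l} \<inter> space M"
    by (auto simp: inv_space topspace_full_shift shift_def appears_at_def)
  moreover have "emeasure M B = emeasure M (shift -` B \<inter> space M)" if "B \<in> sets M" for B
    using inv that by (auto simp: invariant_prob_on_def)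
  ultimately show ?case using inv_sets_appears[of w l] Suc by (simp add: measure_def)
qed (simp add: cylinder_eq)

lemma inv_measure_le_1: "measure M B \<le> 1"
  using prob_space.prob_le_1[OF inv_prob_space] .

lemma inv_measure_eq_1:
  assumes "subshift A X" "X \<subseteq> B" "B \<in> sets M"
  shows "measure M B = 1"
proof -
  have "measure M X = 1" using inv by (simp add: invariant_prob_on_def measure_def)
  then have "1 \<le> measure M B"
    using finite_measure.finite_measure_mono[OF prob_space.finite_measure[OF inv_prob_space] assms(2,3)] by simp
  then show ?thesis using inv_measure_le_1[of B] by simp
qed

text \<open>Infinitely many blocks of length \<open>n\<close> may occur in \<open>X\<close>;
  continuity of the measure along an enumeration yields finitely many of total mass at least
  \<open>1 - \<delta>\<close>. Exchanging the sum over blocks with the sum over positions turns the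
  expected count into a sum of measures, each within \<delta> below the measure of the cylinder of
  \<open>w\<close>.\<close>

lemma finite_block_distribution:
  assumes X: "subshift A X" and cA: "countable A" and "n > 0" and \<delta>: "\<delta> > (0::real)"
  obtains F where "finite F" "\<And>v. v \<in> F \<Longrightarrow> v \<in> language X \<and> length v = n"
    "1 - \<delta> \<le> (\<Sum>v\<in>F. measure M (cylinder A v))" "(\<Sum>v\<in>F. measure M (cylinder A v)) \<le> 1"
    "\<And>w. w \<noteq> [] \<Longrightarrow> length w \<le> n \<Longrightarrow>
        n * measure M (cylinder A w) - length w - n * \<delta> \<le> (\<Sum>v\<in>F. measure M (cylinder A v) * list_occ w v) \<and>
        (\<Sum>v\<in>F. measure M (cylinder A v) * list_occ w v) \<le> n * measure M (cylinder A w)"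
proof -
  interpret prob_space M by (rule inv_prob_space)
  let ?C = "cylinder A"
  define e where "e = from_nat_into (lists A)"
  have e: "range e = lists A"
    unfolding e_def using cA by (intro range_from_nat_into countable_lists) auto
  define F where "F k = {v \<in> e ` {..k}. v \<in> language X \<and> length v = n}" for k
  define Y where "Y k = (\<Union>v\<in>F k. ?C v)" for k
  have finF: "finite (F k)" for k by (simp add: F_def)
  have Y_sets: "Y k \<in> sets M" for k
    unfolding Y_def by (intro sets.finite_UN finF inv_sets_cylinder)
  have "incseq Y"
  proof (rule monoI)
    fix k k' :: nat assume "k \<le> k'"
    then have "F k \<subseteq> F k'" using image_mono[of "{..k}" "{..k'}" e] unfolding F_def by auto
    then show "Y k \<subseteq> Y k'" unfolding Y_def by (rule UN_mono) simp
  qed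
  moreover have "range Y \<subseteq> sets M" using Y_sets by auto
  ultimately have "(\<lambda>k. measure M (Y k)) \<longlonglongrightarrow> measure M (\<Union>k. Y k)"
    by (rule finite_Lim_measure_incseq[rotated])
  moreover have "X \<subseteq> (\<Union>k. Y k)"
  proof
    fix x assume x: "x \<in> X"
    let ?v = "map x [0..<n]"
    have xO: "x \<in> topspace (full_shift A)" using x subshift_subset[OF X] by blast
    then have "?v \<in> range e" unfolding e by (auto simp: topspace_full_shift)
    then obtain k where k: "e k = ?v" by auto
    have "appears_at ?v x 0" by (simp add: appears_at_def)
    then have "?v \<in> language X" using x \<open>n > 0\<close> by (auto simp: language_appears_at_0[OF X])
    then have "?v \<in> F k" by (auto simp: F_def k[symmetric]) (simp add: k)
    moreover have "x \<in> ?C ?v" using xO by (simp add: cylinder_def)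
    ultimately show "x \<in> (\<Union>k. Y k)" unfolding Y_def by blast
  qed
  then have "measure M (\<Union>k. Y k) = 1"
    by (rule inv_measure_eq_1[OF X]) (use Y_sets in auto)
  ultimately have "(\<lambda>k. measure M (Y k)) \<longlonglongrightarrow> 1" by simp
  then have "\<forall>\<^sub>F k in sequentially. measure M (Y k) > 1 - \<delta>"
    by (rule order_tendstoD) (use \<delta> in simp)
  then obtain k where k: "measure M (Y k) > 1 - \<delta>"
    by (auto simp: eventually_sequentially)
  have disj: "disjoint_family_on ?C (F k)"
  proof (unfold disjoint_family_on_def, intro ballI impI)
    fix v v' assume "v \<in> F k" "v' \<in> F k" "v \<noteq> v'"
    then obtain i where "i < n" "v ! i \<noteq> v' ! i" "length v = n" "length v' = n"
      by (auto simp: F_def list_eq_iff_nth_eq)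
    then show "?C v \<inter> ?C v' = {}" by (auto simp: cylinder_def)
  qed
  have sumF: "(\<Sum>v\<in>S. measure M (?C v)) = measure M (\<Union>v\<in>S. ?C v)" if "S \<subseteq> F k" for S
    using that by (intro finite_measure_finite_Union[symmetric] finite_subset[OF that finF])
      (auto intro: inv_sets_cylinder disjoint_family_on_mono[OF that disj])
  have sum1: "(\<Sum>v\<in>F k. measure M (?C v)) = measure M (Y k)"
    using sumF[of "F k"] by (simp add: Y_def)
  show thesis
  proof (rule that[of "F k"])
    show "1 - \<delta> \<le> (\<Sum>v\<in>F k. measure M (?C v))" "(\<Sum>v\<in>F k. measure M (?C v)) \<le> 1"
      unfolding sum1 using k by (simp_all add: inv_measure_le_1)
    fix w :: "'a list" assume w: "w \<noteq> []" "length w \<le> n"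
    define L where "L = {l. l + length w \<le> n}"
    have L: "finite L" "real (card L) = real n - real (length w) + 1"
    proof -
      have "L = {..n - length w}" using w by (auto simp: L_def)
      then show "finite L" "real (card L) = real n - real (length w) + 1" using w by simp_all
    qed
    let ?m = "measure M (?C w)"
    have occ: "real (list_occ w v) = (\<Sum>l\<in>L. of_bool (appears_at w ((!) v) l))" if "v \<in> F k" for v
    proof -
      have "length v = n" using that by (simp add: F_def)
      then have "{l. l + length w \<le> length v \<and> appears_at w ((!) v) l} = {l\<in>L. appears_at w ((!) v) l}"
        by (auto simp: L_def)
      then show ?thesis using L(1) by (simp add: inner_occ_def of_bool_def sum.If_cases Int_def)
    qed
    have "(\<Sum>v\<in>F k. measure M (?C v) * list_occ w v)
        = (\<Sum>v\<in>F k. \<Sum>l\<in>L. measure M (?C v) * of_bool (appears_at w ((!) v) l))"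
      by (rule sum.cong) (simp_all add: occ sum_distrib_left)
    also have "\<dots> = (\<Sum>l\<in>L. \<Sum>v\<in>F k. measure M (?C v) * of_bool (appears_at w ((!) v) l))"
      by (rule sum.swap)
    \<comment> \<open>For a fixed position, the blocks of \<open>F k\<close> showing
      \<open>w\<close> there have disjoint cylinders, whose union is the event "\<open>w\<close> at
      \<open>l\<close>" restricted to \<open>Y k\<close>.\<close>
    also have "\<dots> = (\<Sum>l\<in>L. measure M (Y k \<inter> {z \<in> topspace (full_shift A). appears_at w z l}))"
    proof (rule sum.cong[OF refl])
      fix l assume l: "l \<in> L"
      let ?S = "{v \<in> F k. appears_at w ((!) v) l}"
      have "(\<Sum>v\<in>F k. measure M (?C v) * of_bool (appears_at w ((!) v) l)) = (\<Sum>v\<in>?S. measure M (?C v))"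
        by (rule sum.mono_neutral_cong_right) (auto simp: finF)
      also have "\<dots> = measure M (\<Union>v\<in>?S. ?C v)" by (rule sumF) auto
      also have "(\<Union>v\<in>?S. ?C v) = Y k \<inter> {z \<in> topspace (full_shift A). appears_at w z l}"
      proof -
        have "appears_at w ((!) v) l \<longleftrightarrow> appears_at w z l" if "v \<in> F k" "z \<in> ?C v" for v z
        proof -
          have "z i = v ! i" if "i < n" for i
            using that \<open>v \<in> F k\<close> \<open>z \<in> ?C v\<close> by (auto simp: F_def cylinder_def)
          then show ?thesis using l by (simp add: appears_at_def L_def)
        qed
        moreover have "?C v \<subseteq> topspace (full_shift A)" for v by (auto simp: cylinder_def)
        ultimately show ?thesis unfolding Y_def by blast
      qed
      finally show "(\<Sum>v\<in>F k. measure M (?C v) * of_bool (appears_at w ((!) v) l)) =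
          measure M (Y k \<inter> {z \<in> topspace (full_shift A). appears_at w z l})" .
    qed
    finally have eq: "(\<Sum>v\<in>F k. measure M (?C v) * list_occ w v) =
       (\<Sum>l\<in>L. measure M (Y k \<inter> {z \<in> topspace (full_shift A). appears_at w z l}))" .
    have up: "measure M (Y k \<inter> {z \<in> topspace (full_shift A). appears_at w z l}) \<le> ?m" for l
      unfolding inv_measure_appears[of w l, symmetric]
      by (intro finite_measure_mono inv_sets_appears) auto
    have low: "?m - \<delta> \<le> measure M (Y k \<inter> {z \<in> topspace (full_shift A). appears_at w z l})" for l
    proof -
      let ?S = "{z \<in> topspace (full_shift A). appears_at w z l}"
      have "?m \<le> measure M ((Y k \<inter> ?S) \<union> (space M - Y k))"
        unfolding inv_measure_appears[of w l, symmetric]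
        by (intro finite_measure_mono sets.Un sets.Int Y_sets inv_sets_appears sets.compl_sets)
          (auto simp: inv_space)
      also have "\<dots> \<le> measure M (Y k \<inter> ?S) + measure M (space M - Y k)"
        by (intro measure_Un_le sets.Int Y_sets inv_sets_appears sets.compl_sets)
      also have "measure M (space M - Y k) = 1 - measure M (Y k)" by (rule prob_compl[OF Y_sets])
      finally show ?thesis using k by simp
    qed
    have "(\<Sum>l\<in>L. measure M (Y k \<inter> {z \<in> topspace (full_shift A). appears_at w z l})) \<le> card L * ?m"
      by (rule sum_bounded_above) (rule up)
    also have "\<dots> \<le> n * ?m"
    proof (rule mult_right_mono)
      show "real (card L) \<le> real n" unfolding L using w by (cases w) auto
    qed simp
    finally have U: "(\<Sum>l\<in>L. measure M (Y k \<inter> {z \<in> topspace (full_shift A). appears_at w z l})) \<le> n * ?m" .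
    \<comment> \<open>There are \<open>n - length w + 1\<close> positions. The missing ones cost at
      most \<open>length w\<close> since \<open>?m \<le> 1\<close>, and the remaining terms
      \<open>?m\<close> and \<open>(length w - 1) * \<delta>\<close> are nonnegative.\<close>
    have "n * ?m - length w - n * \<delta> \<le> card L * (?m - \<delta>)"
    proof -
      have "length w * ?m \<le> real (length w) * 1" by (intro mult_left_mono inv_measure_le_1) simp
      moreover have "(real (length w) - 1) * \<delta> \<ge> 0" using w \<delta> by (cases w) auto
      ultimately show ?thesis unfolding L
        by (simp add: algebra_simps) (use measure_nonneg[of M "cylinder A w"] in linarith)
    qed
    also have "\<dots> \<le> (\<Sum>l\<in>L. measure M (Y k \<inter> {z \<in> topspace (full_shift A). appears_at w z l}))"
      by (rule sum_bounded_below) (rule low)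
    finally show "n * ?m - length w - n * \<delta> \<le> (\<Sum>v\<in>F k. measure M (?C v) * list_occ w v) \<and>
        (\<Sum>v\<in>F k. measure M (?C v) * list_occ w v) \<le> n * ?m"
      using U unfolding eq by simp
  qed (auto simp: finF, auto simp: F_def)
qed

text \<open>The mean of \<^term>\<open>list_occ w\<close> over a random block of length \<open>n\<close> is about
  \<open>n \<mu>[w]\<close> by invariance alone, so a list of blocks with nearly these multiplicities replaces the
  ergodic theorem and also covers measures that are not ergodic.\<close>

lemma representative_blocks:
  fixes \<epsilon> :: real
  assumes X: "subshift A X" and cA: "countable A"
    and W: "finite W" "[] \<notin> W" and \<epsilon>: "\<epsilon> > 0"
  obtains N where "\<And>n. n \<ge> N \<Longrightarrow> \<exists>vs. vs \<noteq> [] \<and> set vs \<subseteq> language X \<and> (\<forall>v\<in>set vs. length v = n) \<and>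
     (\<forall>w\<in>W. \<bar>(\<Sum>v\<leftarrow>vs. real (list_occ w v)) - measure M (cylinder A w) * (length vs * n)\<bar> \<le> \<epsilon> * (length vs * n))"
proof -
  \<comment> \<open>The bound \<open>1/4\<close> gives \<open>K \<le> 2 * S\<close>; the total error
    \<open>3 * K * n * \<delta>\<close> then becomes \<open>6 * \<delta> * S * n\<close>, whence the
    \<open>6\<close>.\<close>
  define \<delta> where "\<delta> = min (\<epsilon> / 6) (1/4)"
  have \<delta>: "0 < \<delta>" "\<delta> \<le> 1/4" "6 * \<delta> \<le> \<epsilon>" using \<epsilon> by (auto simp: \<delta>_def)
  obtain D where D: "\<And>w. w \<in> W \<Longrightarrow> length w \<le> D"
    using finite_imageI[OF W(1), of length] unfolding finite_nat_set_iff_bounded_le by auto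
  define N where "N = Suc (D + nat \<lceil>D / \<delta>\<rceil>)"
  show thesis
  proof (rule that[of N])
    fix n assume n: "n \<ge> N"
    then have "n > 0" "D \<le> n" by (auto simp: N_def)
    have "nat \<lceil>D / \<delta>\<rceil> \<le> n" using n unfolding N_def by linarith
    then have "D / \<delta> \<le> n" by linarith
    then have Dn: "D \<le> n * \<delta>" using \<delta>(1) by (simp add: pos_divide_le_eq)
    let ?p = "\<lambda>v. measure M (cylinder A v)"
    obtain F where F: "finite F" "\<And>v. v \<in> F \<Longrightarrow> v \<in> language X \<and> length v = n"
      "1 - \<delta> \<le> (\<Sum>v\<in>F. ?p v)" "(\<Sum>v\<in>F. ?p v) \<le> 1"
      and Fw: "\<And>w. w \<noteq> [] \<Longrightarrow> length w \<le> n \<Longrightarrow>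
        n * ?p w - length w - n * \<delta> \<le> (\<Sum>v\<in>F. ?p v * list_occ w v) \<and>
        (\<Sum>v\<in>F. ?p v * list_occ w v) \<le> n * ?p w"
      using finite_block_distribution[OF X cA \<open>n > 0\<close> \<delta>(1)] by blast
    \<comment> \<open>\<open>K\<close> plays the role of a common denominator for the block
      probabilities. Rounding \<open>K * ?p v\<close> down costs less than one copy per block, in
      total at most \<open>card F \<le> K * \<delta>\<close>.\<close>
    define K where "K = Suc (nat \<lceil>card F / \<delta>\<rceil>)"
    have "card F / \<delta> \<le> K" unfolding K_def by linarith
    then have K: "card F \<le> K * \<delta>" "K \<ge> 1" using \<delta>(1) by (simp_all add: pos_divide_le_eq K_def)
    define a where "a v = nat \<lfloor>K * ?p v\<rfloor>" for v
    have a: "real (a v) \<le> K * ?p v" "K * ?p v - 1 \<le> real (a v)" for v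
    proof -
      have "0 \<le> K * ?p v" by simp
      then show "real (a v) \<le> K * ?p v" "K * ?p v - 1 \<le> real (a v)" unfolding a_def by linarith+
    qed
    obtain vs where vs: "set vs \<subseteq> F" "\<And>f :: 'a list \<Rightarrow> real. (\<Sum>v\<leftarrow>vs. f v) = (\<Sum>v\<in>F. real (a v) * f v)"
      using sum_list_concat_replicate[OF F(1)] by blast
    define S where "S = real (length vs)"
    have S: "S = (\<Sum>v\<in>F. real (a v))"
      using vs(2)[of "\<lambda>_. 1"] by (simp add: S_def sum_list_triv)
    have "S \<le> (\<Sum>v\<in>F. K * ?p v)" unfolding S by (intro sum_mono a)
    also have "\<dots> \<le> K" using F(4) K(2) by (simp flip: sum_distrib_left add: mult_left_le)
    finally have S_le: "S \<le> K" .
    have "K * (1 - \<delta>) - card F \<le> K * (\<Sum>v\<in>F. ?p v) - card F"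
      using F(3) by (simp add: mult_left_mono)
    also have "\<dots> = (\<Sum>v\<in>F. K * ?p v - 1)"
      by (simp add: sum_subtractf sum_distrib_left)
    also have "\<dots> \<le> S" unfolding S by (intro sum_mono a)
    \<comment> \<open>One \<open>K * \<delta>\<close> is the mass outside \<open>F\<close>, the
      other the rounding.\<close>
    finally have S_ge: "K - 2 * (K * \<delta>) \<le> S" using K(1) by (simp add: algebra_simps)
    have K_S: "K \<le> 2 * S"
    proof -
      have "K * \<delta> \<le> K * (1/4)" using \<delta>(2) by (intro mult_left_mono) auto
      then show ?thesis using S_ge by simp
    qed
    have "vs \<noteq> []" using K_S K(2) by (auto simp: S_def)
    moreover have "\<bar>(\<Sum>v\<leftarrow>vs. real (list_occ w v)) - ?p w * (length vs * n)\<bar> \<le> \<epsilon> * (length vs * n)" if w: "w \<in> W" for w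
    proof -
      have w': "w \<noteq> []" "length w \<le> n" "length w \<le> D" using w W(2) D[OF w] \<open>D \<le> n\<close> by auto
      define T where "T = (\<Sum>v\<leftarrow>vs. real (list_occ w v))"
      have T: "T = (\<Sum>v\<in>F. real (a v) * list_occ w v)" unfolding T_def by (rule vs(2))
      have occ: "list_occ w v \<le> n" if "v \<in> F" for v
        using inner_occ_le[OF w'(1), of "(!) v" "length v"] F(2)[OF that] by simp
      define P where "P = (\<Sum>v\<in>F. ?p v * list_occ w v)"
      have P: "n * ?p w - length w - n * \<delta> \<le> P" "P \<le> n * ?p w"
        using Fw[OF w'(1,2)] by (auto simp: P_def)
      have "T \<le> (\<Sum>v\<in>F. K * ?p v * list_occ w v)"
        unfolding T by (intro sum_mono mult_right_mono a) simp
      also have "\<dots> = K * P" by (simp add: P_def sum_distrib_left mult.assoc)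
      also have "\<dots> \<le> K * (n * ?p w)" using P(2) by (intro mult_left_mono) auto
      finally have T_le: "T \<le> K * (n * ?p w)" .
      \<comment> \<open>The three losses are the positions cut off at the end of a block, the mass
        outside \<open>F\<close>, and the rounding.\<close>
      have "K * (n * ?p w) - 3 * (K * (n * \<delta>)) \<le> K * (n * ?p w - length w - n * \<delta>) - card F * n"
      proof -
        have "real K * real (length w) \<le> K * (n * \<delta>)" using w'(3) Dn by (intro mult_left_mono) auto
        moreover have "card F * real n \<le> K * \<delta> * n" using K(1) by (intro mult_right_mono) auto
        ultimately show ?thesis by (simp add: algebra_simps)
      qed
      also have "\<dots> \<le> K * P - card F * n"
        using P(1) by (simp add: mult_left_mono)
      also have "\<dots> \<le> K * P - (\<Sum>v\<in>F. real (list_occ w v))"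
      proof -
        have "(\<Sum>v\<in>F. real (list_occ w v)) \<le> card F * n"
          using sum_bounded_above[of F "\<lambda>v. real (list_occ w v)" "real n"] occ by simp
        then show ?thesis by simp
      qed
      also have "\<dots> = (\<Sum>v\<in>F. (K * ?p v - 1) * list_occ w v)"
        by (simp add: P_def sum_distrib_left sum_subtractf algebra_simps)
      also have "\<dots> \<le> T" unfolding T by (intro sum_mono mult_right_mono a) simp
      finally have T_ge: "K * (n * ?p w) - 3 * (K * (n * \<delta>)) \<le> T" .
      have p01: "0 \<le> ?p w * n" "?p w * n \<le> n"
        using inv_measure_le_1[of "cylinder A w"] by (auto intro: mult_left_le_one_le)
      have "?p w * n * S \<le> ?p w * n * K" using S_le p01 by (intro mult_left_mono)
      moreover have "?p w * n * K - 2 * (K * (n * \<delta>)) \<le> ?p w * n * S"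
      proof -
        have "?p w * n * (K - 2 * (K * \<delta>)) \<le> ?p w * n * S" using S_ge p01 by (intro mult_left_mono)
        moreover have "?p w * n * (2 * (K * \<delta>)) \<le> n * (2 * (K * \<delta>))"
          using p01 \<delta> by (intro mult_right_mono) auto
        ultimately show ?thesis by (simp add: algebra_simps)
      qed
      ultimately have "\<bar>T - ?p w * n * S\<bar> \<le> 3 * (K * (n * \<delta>))"
        using T_le T_ge by (simp add: algebra_simps abs_le_iff)
      also have "\<dots> \<le> 3 * (2 * S * (n * \<delta>))"
        using K_S \<delta> by (intro mult_left_mono mult_right_mono) auto
      also have "\<dots> = 6 * \<delta> * (S * n)" by simp
      also have "\<dots> \<le> \<epsilon> * (S * n)" using \<delta>(3) by (intro mult_right_mono) (auto simp: S_def)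
      finally show ?thesis by (simp add: T_def S_def mult_ac)
    qed
    ultimately show "\<exists>vs. vs \<noteq> [] \<and> set vs \<subseteq> language X \<and> (\<forall>v\<in>set vs. length v = n) \<and>
     (\<forall>w\<in>W. \<bar>(\<Sum>v\<leftarrow>vs. real (list_occ w v)) - ?p w * (length vs * n)\<bar> \<le> \<epsilon> * (length vs * n))"
      using vs(1) F(2) by (intro exI[of _ vs]) auto
  qed
qed

text \<open>The representative list is fixed before \<open>u\<close> is given, so one bound
  \<open>R\<close> on the length of the extension serves all of \<open>G\<close>. The extension is
  nonempty, so that it can be iterated.\<close>

lemma extend_once:
  fixes \<epsilon> :: real
  assumes X: "subshift A X" and cA: "countable A" and G: "feeble_base A X G"
    and W: "finite W" "[] \<notin> W" and \<epsilon>: "\<epsilon> > 0"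
  obtains R :: nat where "\<And>u. u \<in> G \<Longrightarrow> \<exists>t. u @ t \<in> G \<and> 0 < length t \<and> length t \<le> R \<and>
     (\<forall>w\<in>W. \<bar>real (list_occ w (u @ t)) - list_occ w u - measure M (cylinder A w) * length t\<bar> \<le> \<epsilon> * length t)"
proof -
  obtain D where D: "\<And>w. w \<in> W \<Longrightarrow> length w \<le> D"
    using finite_imageI[OF W(1), of length] unfolding finite_nat_set_iff_bounded_le by auto
  \<comment> \<open>Gluing contributes \<open>3 + D\<close> times \<eta>: gaps one, cuts two,
    altered letters \<open>D\<close>. The list being only nearly representative adds one, and the
    excess of \<open>length t\<close> over the total block length adds the last.\<close>
  define \<eta> where "\<eta> = \<epsilon> / (5 + D)"
  have \<eta>: "\<eta> > 0" "\<eta> * (5 + D) = \<epsilon>" using \<epsilon> by (simp_all add: \<eta>_def)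
  obtain N1 where N1: "\<And>n u vs. n \<ge> N1 \<Longrightarrow> u \<in> G \<Longrightarrow> set vs \<subseteq> language X \<Longrightarrow> (\<forall>v\<in>set vs. length v = n) \<Longrightarrow>
      \<exists>t. u @ t \<in> G \<and> length vs * n \<le> length t \<and> length t \<le> (1 + \<eta>) * (length vs * n) \<and>
        (\<forall>w. w \<noteq> [] \<longrightarrow> \<bar>real (list_occ w (u @ t)) - list_occ w u - (\<Sum>v\<leftarrow>vs. real (list_occ w v))\<bar>
            \<le> length vs * (\<eta> * n + 2 * length w + length w * (\<eta> * n)))"
    using glue_blocks[OF G \<eta>(1)] by blast
  obtain N2 where N2: "\<And>n. n \<ge> N2 \<Longrightarrow> \<exists>vs. vs \<noteq> [] \<and> set vs \<subseteq> language X \<and> (\<forall>v\<in>set vs. length v = n) \<and>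
     (\<forall>w\<in>W. \<bar>(\<Sum>v\<leftarrow>vs. real (list_occ w v)) - measure M (cylinder A w) * (length vs * n)\<bar> \<le> \<eta> * (length vs * n))"
    using representative_blocks[OF X cA W \<eta>(1)] by blast
  define n where "n = Suc (N1 + N2 + nat \<lceil>D / \<eta>\<rceil>)"
  have "D / \<eta> \<le> n" unfolding n_def by linarith
  then have Dn: "D \<le> \<eta> * n" using \<eta>(1) by (simp add: pos_divide_le_eq mult.commute)
  obtain vs where vs: "vs \<noteq> []" "set vs \<subseteq> language X" "\<forall>v\<in>set vs. length v = n"
    "\<And>w. w \<in> W \<Longrightarrow> \<bar>(\<Sum>v\<leftarrow>vs. real (list_occ w v)) - measure M (cylinder A w) * (length vs * n)\<bar> \<le> \<eta> * (length vs * n)"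
    using N2[of n] by (auto simp: n_def)
  show thesis
  proof (rule that[of "nat \<lceil>(1 + \<eta>) * (length vs * n)\<rceil>"])
    fix u assume u: "u \<in> G"
    obtain t where t: "u @ t \<in> G" "length vs * n \<le> length t" "length t \<le> (1 + \<eta>) * (length vs * n)"
      and tw: "\<And>w. w \<noteq> [] \<Longrightarrow> \<bar>real (list_occ w (u @ t)) - list_occ w u - (\<Sum>v\<leftarrow>vs. real (list_occ w v))\<bar>
            \<le> length vs * (\<eta> * n + 2 * length w + length w * (\<eta> * n))"
      using N1[OF _ u vs(2,3)] by (auto simp: n_def)
    define m where "m = real (length vs * n)"
    have m: "m \<le> length t" "length t \<le> m + \<eta> * m" "0 \<le> m"
      using t(2,3) by (simp_all add: m_def algebra_simps flip: of_nat_mult)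
    have "\<bar>real (list_occ w (u @ t)) - list_occ w u - measure M (cylinder A w) * length t\<bar> \<le> \<epsilon> * length t"
      if w: "w \<in> W" for w
    proof -
      let ?m = "measure M (cylinder A w)"
      have "length vs * (\<eta> * n + 2 * length w + length w * (\<eta> * n)) \<le> length vs * (\<eta> * n + 2 * (\<eta> * n) + D * (\<eta> * n))"
      proof (intro mult_left_mono add_mono order_refl)
        show "real (2 * length w) \<le> 2 * (\<eta> * n)" using D[OF w] Dn by simp
        show "length w * (\<eta> * n) \<le> D * (\<eta> * n)" using D[OF w] \<eta>(1) by (intro mult_right_mono) auto
      qed (use \<eta>(1) in auto)
      also have "\<dots> = (3 + D) * \<eta> * m" by (simp add: m_def algebra_simps)
      finally have 1: "\<bar>real (list_occ w (u @ t)) - list_occ w u - (\<Sum>v\<leftarrow>vs. real (list_occ w v))\<bar> \<le> (3 + D) * \<eta> * m"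
        using tw[of w] w W(2) by fastforce
      have 2: "\<bar>(\<Sum>v\<leftarrow>vs. real (list_occ w v)) - ?m * m\<bar> \<le> \<eta> * m"
        using vs(4)[OF w] by (simp add: m_def)
      have 3: "\<bar>?m * m - ?m * length t\<bar> \<le> \<eta> * m"
      proof -
        have "?m * (length t - m) \<le> 1 * (length t - m)" using m inv_measure_le_1 by (intro mult_right_mono) auto
        moreover have "0 \<le> ?m * (length t - m)" using m by simp
        ultimately show ?thesis using m by (simp add: algebra_simps abs_le_iff)
      qed
      have "(3 + D) * \<eta> * m + \<eta> * m + \<eta> * m = \<eta> * (5 + D) * m" by (simp add: algebra_simps)
      also have "\<dots> = \<epsilon> * m" by (simp only: \<eta>(2))
      also have "\<dots> \<le> \<epsilon> * length t" using m \<epsilon> by (intro mult_left_mono) auto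
      finally show ?thesis using 1 2 3 by linarith
    qed
    moreover have "0 < length t" using t(2) vs(1) by (auto simp: n_def)
    moreover have "length t \<le> nat \<lceil>(1 + \<eta>) * (length vs * n)\<rceil>" using t(3) by linarith
    ultimately show "\<exists>t. u @ t \<in> G \<and> 0 < length t \<and> length t \<le> nat \<lceil>(1 + \<eta>) * (length vs * n)\<rceil> \<and>
     (\<forall>w\<in>W. \<bar>real (list_occ w (u @ t)) - list_occ w u - measure M (cylinder A w) * length t\<bar> \<le> \<epsilon> * length t)"
      using t(1) by blast
  qed
qed

text \<open>Rounds of \<open>extend_once\<close> are iterated until length \<open>n\<close> is
  reached, overshooting by at most one round. A complete round costs a multiple of its length and
  nothing else, so these costs add up to \<open>\<epsilon> * j\<close>; the additive
  \<open>R\<close> is paid once, for the single incomplete round in which the cut-off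
  \<open>j\<close> falls.\<close>

lemma extend_to_length:
  fixes \<epsilon> :: real
  assumes X: "subshift A X" and cA: "countable A" and G: "feeble_base A X G"
    and W: "finite W" "[] \<notin> W" and \<epsilon>: "\<epsilon> > 0"
  obtains R :: nat where "\<And>u n. u \<in> G \<Longrightarrow> \<exists>t. u @ t \<in> G \<and> n \<le> length t \<and> length t \<le> n + R \<and>
     (\<forall>w\<in>W. \<forall>j\<le>length t. \<bar>real (inner_occ w ((!) (u @ t)) (length u + j)) - list_occ w u
        - measure M (cylinder A w) * j\<bar> \<le> \<epsilon> * j + R)"
proof -
  obtain R :: nat where R: "\<And>u. u \<in> G \<Longrightarrow> \<exists>t. u @ t \<in> G \<and> 0 < length t \<and> length t \<le> R \<and>
     (\<forall>w\<in>W. \<bar>real (list_occ w (u @ t)) - list_occ w u - measure M (cylinder A w) * length t\<bar> \<le> \<epsilon> * length t)"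
    using extend_once[OF X cA G W \<epsilon>] by blast
  have pre: "inner_occ w ((!) (u @ t)) (length u) = list_occ w u" for w u and t :: "'a list"
    by (rule inner_occ_cong) (simp add: nth_append)
  \<comment> \<open>Inside a round both the gain in occurrences and its expected value lie between
    \<open>0\<close> and \<open>j\<close>, so they differ by at most \<open>R\<close>.\<close>
  have short: "\<bar>real (inner_occ w ((!) (u @ t)) (length u + j)) - list_occ w u - measure M (cylinder A w) * j\<bar>
      \<le> \<epsilon> * j + R" if "w \<in> W" "j \<le> R" for w u t j
  proof -
    have "w \<noteq> []" using that W(2) by blast
    then have "list_occ w u \<le> inner_occ w ((!) (u @ t)) (length u + j)"
      "inner_occ w ((!) (u @ t)) (length u + j) \<le> list_occ w u + j"
      using inner_occ_add_le[of w "(!) (u @ t)" "length u" j]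
        inner_occ_mono[of "length u" "length u + j" w "(!) (u @ t)"] by (simp_all add: pre)
    moreover have "0 \<le> measure M (cylinder A w) * j" "measure M (cylinder A w) * j \<le> j"
      using inv_measure_le_1[of "cylinder A w"] by (auto intro: mult_left_le_one_le)
    moreover have "0 \<le> \<epsilon> * j" using \<epsilon> by simp
    ultimately show ?thesis using that(2) by linarith
  qed
  show thesis
  proof (rule that[of R])
    fix u n assume "u \<in> G"
    then show "\<exists>t. u @ t \<in> G \<and> n \<le> length t \<and> length t \<le> n + R \<and>
     (\<forall>w\<in>W. \<forall>j\<le>length t. \<bar>real (inner_occ w ((!) (u @ t)) (length u + j)) - list_occ w u
        - measure M (cylinder A w) * j\<bar> \<le> \<epsilon> * j + R)"
    proof (induction n arbitrary: u rule: less_induct)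
      case (less n)
      obtain t where t: "u @ t \<in> G" "0 < length t" "length t \<le> R"
        and tw: "\<And>w. w \<in> W \<Longrightarrow> \<bar>real (list_occ w (u @ t)) - list_occ w u - measure M (cylinder A w) * length t\<bar> \<le> \<epsilon> * length t"
        using R[OF less.prems] by blast
      show ?case
      proof (cases "n \<le> length t")
        case True
        then show ?thesis using t short by (intro exI[of _ t]) auto
      next
        case False
        then obtain t' where t': "(u @ t) @ t' \<in> G" "n - length t \<le> length t'" "length t' \<le> n - length t + R"
          and tw': "\<And>w j. w \<in> W \<Longrightarrow> j \<le> length t' \<Longrightarrow> \<bar>real (inner_occ w ((!) ((u @ t) @ t')) (length (u @ t) + j)) - list_occ w (u @ t)
        - measure M (cylinder A w) * j\<bar> \<le> \<epsilon> * j + R"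
          using less.IH[OF _ t(1), of "n - length t"] t(2) by fastforce
        have "\<bar>real (inner_occ w ((!) (u @ t @ t')) (length u + j)) - list_occ w u
            - measure M (cylinder A w) * j\<bar> \<le> \<epsilon> * j + R" if w: "w \<in> W" and j: "j \<le> length (t @ t')" for w j
        proof (cases "j \<le> length t")
          case True
          then show ?thesis using short[OF w] t(3) by simp
        next
          case False
          then obtain i where i: "j = length t + i" using le_Suc_ex nat_le_linear by blast
          then have "\<bar>real (inner_occ w ((!) (u @ t @ t')) (length u + j)) - list_occ w (u @ t)
            - measure M (cylinder A w) * i\<bar> \<le> \<epsilon> * i + R"
            using tw'[OF w, of i] j by (simp add: add.assoc)
          then show ?thesis using tw[OF w] unfolding i by (simp add: algebra_simps abs_le_iff)
        qed
        then show ?thesis using t' False by (intro exI[of _ "t @ t'"]) auto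
      qed
    qed
  qed
qed

end

section \<open>Frequencies along the stages\<close>

text \<open>The whole oscillation argument for one test block with count \<open>c\<close>: the
  \<mu>-part of stage \<open>k\<close> runs from \<open>p k\<close> to \<open>q k\<close> with
  target frequency \<open>a\<close>, the \<nu>-part from \<open>q k\<close> to
  \<open>p (Suc k)\<close> with target \<open>b\<close>. \<open>K0\<close> is the stage from which
  the block is tested. By \<open>pq\<close> the \<mu>-part outweighs its past by the factor
  \<open>Suc k\<close>, and by \<open>qp\<close> the \<nu>-part has length about
  \<open>q k / Suc (m k)\<close>.\<close>

lemma frequency_analysis:
  fixes c :: "nat \<Rightarrow> nat" and p q R m :: "nat \<Rightarrow> nat" and a b :: real
  assumes c: "\<And>N. c N \<le> N" "\<And>N j. c N \<le> c (N + j)" "\<And>N j. c (N + j) \<le> c N + j"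
    and a: "0 \<le> a" "a \<le> 1"
    and stage_a: "\<And>k j. k \<ge> K0 \<Longrightarrow> p k + j \<le> q k \<Longrightarrow>
          \<bar>real (c (p k + j)) - c (p k) - a * j\<bar> \<le> 1 / Suc k * j + R k"
    and stage_b: "\<And>k j. k \<ge> K0 \<Longrightarrow> q k + j \<le> p (Suc k) \<Longrightarrow>
          \<bar>real (c (q k + j)) - c (q k) - b * j\<bar> \<le> 1 / Suc k * j + R k"
    and pq: "\<And>k. p k + Suc k * (p k + R k + R (Suc k) + 1) \<le> q k"
    and qp: "\<And>k. q k + Suc (q k div Suc (m k)) \<le> p (Suc k)"
            "\<And>k. p (Suc k) \<le> q k + Suc (q k div Suc (m k)) + R k"
  shows "filterlim m at_top sequentially \<Longrightarrow> (\<lambda>N. c N / N) \<longlonglongrightarrow> a"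
    and "\<not> filterlim m at_top sequentially \<Longrightarrow> a \<noteq> b \<Longrightarrow> \<not> convergent (\<lambda>N. c N / N)"
proof -
  define e where "e k = 1 / real (Suc k)" for k
  have e: "e k > 0" "e (Suc k) \<le> e k" for k by (simp_all add: e_def frac_le)
  have e0: "e \<longlonglongrightarrow> 0"
    unfolding e_def using LIMSEQ_inverse_real_of_nat by (simp add: inverse_eq_divide)
  define \<Delta> where "\<Delta> N = real (c N) - a * N" for N
  have \<Delta>_le: "\<bar>\<Delta> N\<bar> \<le> N" for N
  proof -
    have "0 \<le> a * N" "a * N \<le> N" using a by (auto intro: mult_left_le_one_le)
    then show ?thesis using c(1)[of N] unfolding \<Delta>_def by linarith
  qed
  have \<Delta>_step: "\<bar>\<Delta> (N + j)\<bar> \<le> \<bar>\<Delta> N\<bar> + j" for N j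
  proof -
    have "0 \<le> a * j" "a * j \<le> j" using a by (auto intro: mult_left_le_one_le)
    then show ?thesis using c(2,3)[of N j] unfolding \<Delta>_def by (simp add: distrib_left)
  qed
  \<comment> \<open>\<open>R (Suc k)\<close> is included because the start of the next \<mu>-part,
    where that constant is not yet small against the new length, is already compared with
    \<open>q k\<close>.\<close>
  have small: "p k + R k + R (Suc k) + 1 \<le> e k * q k" for k
  proof -
    have "real (Suc k * (p k + R k + R (Suc k) + 1)) \<le> real (q k)"
      using pq[of k] by linarith
    then show ?thesis by (simp add: e_def field_simps)
  qed
  have p_less_q: "p k < q k" for k using pq[of k] by simp
  have q_less_p: "q k < p (Suc k)" for k using qp(1)[of k] by simp
  have mono_q: "strict_mono q"
    by (simp add: strict_mono_Suc_iff) (meson less_trans p_less_q q_less_p)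
  have q_pos: "q k > 0" for k using p_less_q[of k] by simp
  \<comment> \<open>One \<open>e k\<close> is the relative error of the \<mu>-part, the other covers
    \<open>R k\<close> and the past up to \<open>p k\<close>, where the deviation is bounded
    trivially by \<open>p k\<close>. Nothing about \<open>m\<close> is used.\<close>
  have at_q: "\<bar>\<Delta> (q k)\<bar> \<le> 2 * e k * q k" if "k \<ge> K0" for k
  proof -
    have "p k + (q k - p k) = q k" using p_less_q[of k] by simp
    then have "\<bar>real (c (q k)) - c (p k) - a * (q k - p k)\<bar> \<le> e k * (q k - p k) + R k"
      using stage_a[OF that, of "q k - p k"] by (simp add: e_def)
    moreover have "real (q k - p k) = real (q k) - real (p k)" using p_less_q[of k] by simp
    moreover have "0 \<le> e k * p k" using e(1)[of k] by simp
    ultimately have "\<bar>\<Delta> (q k) - \<Delta> (p k)\<bar> \<le> e k * q k + R k"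
      unfolding \<Delta>_def by (simp add: right_diff_distrib abs_le_iff)
    then show ?thesis using small[of k] \<Delta>_le[of "p k"] by linarith
  qed
  \<comment> \<open>On a \<nu>-part the deviation grows by at most one per letter, so the length of
    the part alone bounds the damage, whatever \<open>b\<close> is.\<close>
  have to_p: "\<bar>\<Delta> N\<bar> \<le> (4 * e k + 1 / Suc (m k)) * N" if k: "k \<ge> K0" "q k \<le> N" "N \<le> p (Suc k)" for k N
  proof -
    have "real (N - q k) \<le> real (q k div Suc (m k)) + 1 + R k" using qp(2)[of k] k(3) by linarith
    also have "real (q k div Suc (m k)) \<le> q k / Suc (m k)" by (rule of_nat_div_le_of_nat)
    finally have "real (N - q k) \<le> (e k + 1 / Suc (m k)) * q k"
      using small[of k] by (simp add: distrib_right)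
    then have "\<bar>\<Delta> N\<bar> \<le> (3 * e k + 1 / Suc (m k)) * q k"
      using \<Delta>_step[of "q k" "N - q k"] at_q[OF k(1)] k(2) by (simp add: distrib_right)
    also have "\<dots> \<le> (4 * e k + 1 / Suc (m k)) * N"
      using k(2) e(1)[of k] by (intro mult_mono) auto
    finally show ?thesis .
  qed
  have to_q: "\<bar>\<Delta> N\<bar> \<le> (6 * e k + 1 / Suc (m k)) * N" if k: "k \<ge> K0" "q k \<le> N" "N \<le> q (Suc k)" for k N
  proof (cases "N \<le> p (Suc k)")
    case True
    then have "\<bar>\<Delta> N\<bar> \<le> (4 * e k + 1 / Suc (m k)) * N" using to_p k by simp
    also have "\<dots> \<le> (6 * e k + 1 / Suc (m k)) * N" using e(1)[of k] by (intro mult_right_mono) auto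
    finally show ?thesis .
  next
    case False
    define P where "P = p (Suc k)"
    have P: "P + (N - P) = N" "P \<le> N" "real (N - P) = real N - real P" using False by (auto simp: P_def)
    have "\<bar>real (c N) - c P - a * (N - P)\<bar> \<le> e (Suc k) * (N - P) + R (Suc k)"
      using stage_a[of "Suc k" "N - P"] k P by (simp add: e_def P_def)
    then have "\<bar>\<Delta> N - \<Delta> P\<bar> \<le> e (Suc k) * (N - P) + R (Suc k)"
      unfolding \<Delta>_def using P(3) by (simp add: right_diff_distrib abs_le_iff)
    also have "\<dots> \<le> e k * N + R (Suc k)"
      using e[of k] e(1)[of "Suc k"] by (intro add_right_mono mult_mono) auto
    also have "real (R (Suc k)) \<le> e k * q k" using small[of k] by linarith
    also have "e k * q k \<le> e k * N" using k(2) e(1)[of k] by (intro mult_left_mono) auto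
    finally have "\<bar>\<Delta> N - \<Delta> P\<bar> \<le> 2 * (e k * N)" by linarith
    moreover have "\<bar>\<Delta> P\<bar> \<le> (4 * e k + 1 / Suc (m k)) * P"
      using to_p[OF k(1), of P] q_less_p[of k] by (simp add: P_def)
    moreover have "(4 * e k + 1 / Suc (m k)) * P \<le> (4 * e k + 1 / Suc (m k)) * N"
      using P(2) e(1)[of k] by (intro mult_left_mono) auto
    ultimately show ?thesis by (simp add: distrib_right)
  qed
  have freq: "\<bar>c N / N - a\<bar> = \<bar>\<Delta> N\<bar> / N" if "N > 0" for N
    using that by (simp add: \<Delta>_def field_simps)
  show "(\<lambda>N. c N / N) \<longlonglongrightarrow> a" if m: "filterlim m at_top sequentially"
  proof (rule LIMSEQ_I)
    fix r :: real assume r: "r > 0"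
    have "(\<lambda>k. 1 / real (Suc (m k))) \<longlonglongrightarrow> 0"
      using filterlim_compose[OF LIMSEQ_inverse_real_of_nat m] by (simp add: inverse_eq_divide)
    then have "(\<lambda>k. 6 * e k + 1 / Suc (m k)) \<longlonglongrightarrow> 6 * 0 + 0"
      by (intro tendsto_add tendsto_mult tendsto_const e0)
    then have "\<forall>\<^sub>F k in sequentially. 6 * e k + 1 / Suc (m k) < r"
      using r by (intro order_tendstoD) simp_all
    then obtain K1 where K1: "\<And>k. k \<ge> K1 \<Longrightarrow> 6 * e k + 1 / Suc (m k) < r"
      by (auto simp: eventually_sequentially)
    show "\<exists>no. \<forall>N\<ge>no. norm (c N / N - a) < r"
    proof (intro exI allI impI)
      fix N assume N: "q (max K0 K1) \<le> N"
      obtain k where k: "k \<ge> max K0 K1" "q k \<le> N" "N < q (Suc k)"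
        using strict_mono_between[OF mono_q N] by blast
      have "N > 0" using k(2) q_pos[of k] by simp
      have "\<bar>\<Delta> N\<bar> \<le> (6 * e k + 1 / Suc (m k)) * N" using to_q[of k N] k by simp
      also have "\<dots> < r * N" using K1[of k] k(1) \<open>N > 0\<close> by (intro mult_strict_right_mono) auto
      finally show "norm (c N / N - a) < r"
        using freq[OF \<open>N > 0\<close>] \<open>N > 0\<close> by (simp add: pos_divide_less_eq)
    qed
  qed
  show "\<not> convergent (\<lambda>N. c N / N)" if m: "\<not> filterlim m at_top sequentially" and "a \<noteq> b"
  proof
    assume "convergent (\<lambda>N. c N / N)"
    then obtain L where L: "(\<lambda>N. c N / N) \<longlonglongrightarrow> L" by (auto simp: convergent_def)
    \<comment> \<open>The ends of the \<mu>-parts leave \<open>a\<close> as the only possible limit,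
      for every \<open>m\<close>.\<close>
    have "(\<lambda>k. c (q k) / q k) \<longlonglongrightarrow> a"
    proof (rule LIM_zero_cancel, rule Lim_null_comparison)
      show "\<forall>\<^sub>F k in sequentially. norm (c (q k) / q k - a) \<le> 2 * e k"
        unfolding eventually_sequentially
      proof (intro exI allI impI)
        fix k assume "k \<ge> K0"
        then show "norm (c (q k) / q k - a) \<le> 2 * e k"
          using at_q[of k] freq[OF q_pos[of k]] q_pos[of k] by (simp add: pos_divide_le_eq)
      qed
      show "(\<lambda>k. 2 * e k) \<longlonglongrightarrow> 0" using tendsto_mult_right_zero[OF e0] by simp
    qed
    moreover have "(\<lambda>k. c (q k) / q k) \<longlonglongrightarrow> L"
      using LIMSEQ_subseq_LIMSEQ[OF L mono_q] by (simp add: o_def)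
    ultimately have "L = a" by (rule LIMSEQ_unique[rotated])
    obtain Z where Z: "\<exists>\<^sub>F k in sequentially. m k < Z"
      using m by (auto simp: filterlim_at_top frequently_def not_less)
    \<comment> \<open>When \<open>m k < Z\<close>, the \<nu>-part fills at least the share
      \<open>1 / (Z + 2)\<close> of the first \<open>p (Suc k)\<close> letters, so it should move
      the frequency away from \<open>a\<close> by about \<open>d\<close> or more.\<close>
    define d where "d = \<bar>b - a\<bar> / (Z + 2)"
    have d: "d > 0" using \<open>a \<noteq> b\<close> by (simp add: d_def)
    have "strict_mono (\<lambda>k. p (Suc k))"
      by (simp add: strict_mono_Suc_iff) (meson less_trans p_less_q q_less_p)
    then have "(\<lambda>k. c (p (Suc k)) / p (Suc k)) \<longlonglongrightarrow> a"
      using LIMSEQ_subseq_LIMSEQ[OF L, of "\<lambda>k. p (Suc k)"] \<open>L = a\<close> by (simp add: o_def)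
    then have "(\<lambda>k. (c (p (Suc k)) / p (Suc k) - a)) \<longlonglongrightarrow> 0" by (rule LIM_zero)
    then have "(\<lambda>k. \<bar>c (p (Suc k)) / p (Suc k) - a\<bar> + 4 * e k) \<longlonglongrightarrow> \<bar>0\<bar> + 4 * 0"
      by (intro tendsto_add tendsto_mult tendsto_const tendsto_rabs e0)
    then have "\<forall>\<^sub>F k in sequentially. \<bar>c (p (Suc k)) / p (Suc k) - a\<bar> + 4 * e k < d"
      using d by (intro order_tendstoD) simp_all
    then have "\<forall>\<^sub>F k in sequentially. \<bar>c (p (Suc k)) / p (Suc k) - a\<bar> + 4 * e k < d \<and> k \<ge> K0"
      by (intro eventually_conj eventually_ge_at_top)
    then obtain k where k: "\<bar>c (p (Suc k)) / p (Suc k) - a\<bar> + 4 * e k < d" "k \<ge> K0" "m k < Z"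
      using frequently_eventually_conj[OF Z] by (auto dest!: frequently_ex)
    define P Q where "P = p (Suc k)" and "Q = q k"
    have PQ: "Q < P" "P > 0" "real (P - Q) = real P - real Q"
      using q_less_p[of k] by (auto simp: P_def Q_def)
    have "\<bar>real (c P) - c Q - b * (P - Q)\<bar> \<le> e k * (P - Q) + R k"
      using stage_b[OF k(2), of "P - Q"] PQ by (simp add: e_def P_def Q_def)
    moreover have "e k * (P - Q) \<le> e k * P" using e(1)[of k] PQ by simp
    moreover have "R k \<le> e k * Q" using small[of k] by (simp add: Q_def)
    moreover have "e k * Q \<le> e k * P" using e(1)[of k] PQ by simp
    moreover have "\<bar>\<Delta> Q\<bar> \<le> 2 * (e k * Q)" using at_q[OF k(2)] by (simp add: Q_def)
    moreover have "(b - a) * (P - Q) = (\<Delta> P - \<Delta> Q) - (real (c P) - c Q - b * (P - Q))"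
      unfolding \<Delta>_def PQ(3) by (simp add: algebra_simps)
    ultimately have "\<bar>(b - a) * (P - Q)\<bar> \<le> \<bar>\<Delta> P\<bar> + 4 * (e k * P)" by linarith
    then have "\<bar>b - a\<bar> * (P - Q) \<le> \<bar>\<Delta> P\<bar> + 4 * (e k * P)" by (simp add: abs_mult)
    also have "\<bar>\<Delta> P\<bar> + 4 * (e k * P) < d * P"
    proof -
      have "\<bar>\<Delta> P\<bar> / P + 4 * e k < d" using k(1) freq[OF PQ(2)] by (simp add: P_def)
      then have "(\<bar>\<Delta> P\<bar> / P + 4 * e k) * P < d * P" using PQ(2) by (intro mult_strict_right_mono) auto
      then show ?thesis using PQ(2) by (simp add: distrib_right)
    qed
    also have "d * P \<le> \<bar>b - a\<bar> * (P - Q)"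
    proof -
      \<comment> \<open>Integer division rounds down; the extra \<open>Suc\<close> in the length of
        the \<nu>-part makes up for it. This gives \<open>Q \<le> (Z + 1) * (P - Q)\<close>, and
        adding \<open>P - Q\<close> yields the factor \<open>Z + 2\<close>.\<close>
      have "Q \<le> Suc (m k) * (Q div Suc (m k)) + m k"
        by (metis add_le_mono1 div_mult_mod_eq le_refl less_Suc_eq_le mod_less_divisor mult.commute nat_add_left_cancel_le zero_less_Suc)
      also have "\<dots> \<le> Suc (m k) * Suc (Q div Suc (m k))" by simp
      also have "\<dots> \<le> (Z + 1) * (P - Q)"
        using k(3) qp(1)[of k] unfolding P_def Q_def by (intro mult_le_mono) auto
      finally have "real Q \<le> real ((Z + 1) * (P - Q))" by (simp only: of_nat_le_iff)
      then have "real Q \<le> (real Z + 1) * real (P - Q)" by (simp only: of_nat_mult of_nat_add of_nat_1)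
      then have "P \<le> (real Z + 2) * real (P - Q)" unfolding PQ(3) by (simp add: algebra_simps)
      then have "P / (real Z + 2) \<le> P - Q" by (simp add: divide_le_eq mult.commute)
      then have "\<bar>b - a\<bar> * (P / (real Z + 2)) \<le> \<bar>b - a\<bar> * (P - Q)" by (intro mult_left_mono) auto
      then show ?thesis by (simp add: d_def add.commute)
    qed
    finally show False by simp
  qed
qed

section \<open>Cylinders determine invariant measures\<close>

text \<open>Over a countable alphabet an open set is a countable union of cylinders. The empty set
  joins the generator because disjoint cylinders must also intersect in a member of it.\<close>

lemma sigma_sets_cylinders:
  assumes "countable A"
  shows "sigma_sets (topspace (full_shift A)) {U. openin (full_shift A) U} =
    sigma_sets (topspace (full_shift A)) (insert {} (cylinder A ` lists A))"
proof (rule sigma_sets_eqI)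
  fix U assume "U \<in> {U. openin (full_shift A) U}"
  then have U: "openin (full_shift A) U" by simp
  define B where "B = {cylinder A w |w. w \<in> lists A \<and> cylinder A w \<subseteq> U}"
  have "U = \<Union>B"
  proof
    show "U \<subseteq> \<Union>B"
    proof
      fix x assume x: "x \<in> U"
      then obtain n where n: "\<forall>y\<in>topspace (full_shift A). (\<forall>i<n. y i = x i) \<longrightarrow> y \<in> U"
        using U unfolding openin_full_shift_iff by blast
      have xO: "x \<in> topspace (full_shift A)" using x openin_subset[OF U] by blast
      let ?w = "map x [0..<n]"
      have "?w \<in> lists A" using xO by (auto simp: topspace_full_shift)
      moreover have "x \<in> cylinder A ?w" using xO by (simp add: cylinder_def)
      moreover have "cylinder A ?w \<subseteq> U" using n by (auto simp: cylinder_def)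
      ultimately show "x \<in> \<Union>B" unfolding B_def by blast
    qed
  qed (auto simp: B_def)
  moreover have "B \<subseteq> cylinder A ` lists A" by (auto simp: B_def)
  then have "countable B" using assms by (meson countable_image countable_lists countable_subset)
  then have "\<Union>B \<in> sigma_sets (topspace (full_shift A)) (insert {} (cylinder A ` lists A))"
    by (rule sigma_sets_UNION) (auto simp: B_def intro!: sigma_sets.Basic)
  ultimately show "U \<in> sigma_sets (topspace (full_shift A)) (insert {} (cylinder A ` lists A))" by simp
next
  fix C assume "C \<in> insert {} (cylinder A ` lists A)"
  then show "C \<in> sigma_sets (topspace (full_shift A)) {U. openin (full_shift A) U}"
    by (auto simp: cylinder_eq intro!: sigma_sets.Basic openin_appears_at)
qed

text \<open>Two cylinders are nested or disjoint, according to whether the shorter block is a prefix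
  of the longer one.\<close>

lemma Int_stable_cylinders: "Int_stable (insert {} (cylinder A ` lists A))"
proof -
  have *: "cylinder A v \<inter> cylinder A w \<in> {{}, cylinder A w}" if "length v \<le> length w" for v w
  proof (cases "\<forall>i<length v. w ! i = v ! i")
    case True
    then show ?thesis using that by (auto simp: cylinder_def)
  next
    case False
    then show ?thesis using that by (force simp: cylinder_def)
  qed
  have "cylinder A v \<inter> cylinder A w \<in> insert {} (cylinder A ` lists A)"
    if "v \<in> lists A" "w \<in> lists A" for v w
    using *[of v w] *[of w v] that by (cases "length v \<le> length w") (auto simp: Int_commute)
  then show ?thesis unfolding Int_stable_def by auto
qed

text \<open>Uniqueness of measures on an intersection-stable generator gives a distinguishing block.
  It is nonempty because both total masses are \<open>1\<close>, and it lies in the language because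
  the cylinder of any other nonempty block misses \<open>X\<close> and is null for both
  measures.\<close>

lemma invariant_measures_differ:
  assumes cA: "countable A" and X: "subshift A X"
    and M: "invariant_prob_on A X M" and N: "invariant_prob_on A X N" and "M \<noteq> N"
  obtains w where "w \<in> language X" "measure M (cylinder A w) \<noteq> measure N (cylinder A w)"
proof -
  let ?\<Omega> = "topspace (full_shift A)"
  let ?E = "insert {} (cylinder A ` lists A)"
  interpret M: prob_space M by (rule inv_prob_space[OF M])
  interpret N: prob_space N by (rule inv_prob_space[OF N])
  have \<Omega>: "cylinder A [] = ?\<Omega>" by (simp add: cylinder_def)
  have "\<exists>w\<in>lists A. measure M (cylinder A w) \<noteq> measure N (cylinder A w)"
  proof (rule ccontr)
    assume "\<not> ?thesis"
    then have eq: "measure M (cylinder A w) = measure N (cylinder A w)" if "w \<in> lists A" for w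
      using that by blast
    have "M = N"
    proof (rule measure_eqI_generator_eq[where A="\<lambda>_. ?\<Omega>"])
      show "Int_stable ?E" by (rule Int_stable_cylinders)
      show "?E \<subseteq> Pow ?\<Omega>" by (auto simp: cylinder_def)
      show "emeasure M C = emeasure N C" if "C \<in> ?E" for C
        using that eq by (auto simp: M.emeasure_eq_measure N.emeasure_eq_measure)
      show "sets M = sigma_sets ?\<Omega> ?E" "sets N = sigma_sets ?\<Omega> ?E"
        by (simp_all add: inv_sets[OF M] inv_sets[OF N] sets_borel_of sigma_sets_cylinders[OF cA])
      show "range (\<lambda>_::nat. ?\<Omega>) \<subseteq> ?E" using \<Omega> by blast
    qed auto
    with \<open>M \<noteq> N\<close> show False by simp
  qed
  then obtain w where w: "w \<in> lists A" "measure M (cylinder A w) \<noteq> measure N (cylinder A w)" by blast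
  have "w \<noteq> []"
  proof
    assume "w = []"
    then show False using w(2) M.prob_space N.prob_space
      by (simp add: \<Omega> inv_space[OF M, symmetric]) (simp add: inv_space[OF M] inv_space[OF N])
  qed
  have "w \<in> language X"
  proof (rule ccontr)
    assume "w \<notin> language X"
    then have sub: "X \<subseteq> ?\<Omega> - cylinder A w"
      using \<open>w \<noteq> []\<close> subshift_subset[OF X] by (auto simp: language_appears_at_0[OF X] cylinder_eq)
    have "measure L (cylinder A w) = 0" if L: "invariant_prob_on A X L" for L
    proof -
      interpret prob_space L by (rule inv_prob_space[OF L])
      have "prob (space L - cylinder A w) = 1"
        using sub inv_sets_cylinder[OF L, of w]
        by (intro inv_measure_eq_1[OF L X] sets.compl_sets) (auto simp: inv_space[OF L])
      then show ?thesis using prob_compl[OF inv_sets_cylinder[OF L, of w]] by simp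
    qed
    then show False using w(2) M N by simp
  qed
  with w(2) show thesis by (rule that[rotated])
qed

section \<open>The reduction\<close>

text \<open>The second property is continuity in a strong form: letter \<open>n\<close> of the image
  depends on the first \<open>n + 1\<close> entries only. It makes preimages of open sets
  open.\<close>

lemma reduction_map:
  assumes cA: "countable A" and X: "subshift A X" and G: "feeble_base A X G"
    and M: "invariant_prob_on A X M" and N: "invariant_prob_on A X N"
  obtains \<phi> :: "(nat \<Rightarrow> nat) \<Rightarrow> nat \<Rightarrow> 'a" where
    "\<And>\<alpha>. \<phi> \<alpha> \<in> X"
    "\<And>\<alpha> \<beta> n. (\<And>i. i \<le> n \<Longrightarrow> \<beta> i = \<alpha> i) \<Longrightarrow> \<phi> \<beta> n = \<phi> \<alpha> n"
    "\<And>\<alpha> w. filterlim \<alpha> at_top sequentially \<Longrightarrow> w \<in> lists A \<Longrightarrow> w \<noteq> [] \<Longrightarrow>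
       (\<lambda>n. real (occurrences w (\<phi> \<alpha>) n) / real n) \<longlonglongrightarrow> measure M (cylinder A w)"
    "\<And>\<alpha> w. \<not> filterlim \<alpha> at_top sequentially \<Longrightarrow> w \<in> lists A \<Longrightarrow> w \<noteq> [] \<Longrightarrow>
       measure M (cylinder A w) \<noteq> measure N (cylinder A w) \<Longrightarrow>
       \<not> convergent (\<lambda>n. real (occurrences w (\<phi> \<alpha>) n) / real n)"
proof -
  \<comment> \<open>The test blocks of stage \<open>k\<close>: those of index at most
    \<open>k\<close> in an enumeration, so a block once tested is tested in all later
    stages.\<close>
  define W where "W k = {w \<in> lists A. w \<noteq> [] \<and> to_nat_on (lists A) w \<le> k}" for k
  have W: "finite (W k)" "[] \<notin> W k" for k
  proof -
    have "inj_on (to_nat_on (lists A)) (W k)"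
      by (rule inj_on_subset[OF inj_on_to_nat_on[OF countable_lists[OF cA]]]) (auto simp: W_def)
    then show "finite (W k)" by (rule inj_on_finite[where B="{..k}"]) (auto simp: W_def)
  qed (simp add: W_def)
  define good where "good L k R u n t \<longleftrightarrow> u @ t \<in> G \<and> n \<le> length t \<and> length t \<le> n + R \<and>
     (\<forall>w\<in>W k. \<forall>j\<le>length t. \<bar>real (inner_occ w ((!) (u @ t)) (length u + j)) - list_occ w u
        - measure L (cylinder A w) * j\<bar> \<le> 1 / Suc k * j + real R)"
    for L k R u n and t :: "'a list"
  have mono: "good L k R' u n t" if "good L k R u n t" "R \<le> R'" for L k R R' u n t
  proof -
    have "real R \<le> R'" using that by simp
    then show ?thesis using that unfolding good_def by (meson add_left_mono order_trans)
  qed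
  have ex: "\<exists>R. \<forall>u\<in>G. \<forall>n. \<exists>t. good L k R u n t" if L: "invariant_prob_on A X L" for L k
  proof -
    have "1 / real (Suc k) > 0" by simp
    from extend_to_length[OF L X cA G W this] obtain R where
      R: "\<And>u n. u \<in> G \<Longrightarrow> \<exists>t. good L k R u n t" unfolding good_def by metis
    then show ?thesis by blast
  qed
  \<comment> \<open>One constant per stage for both measures, chosen before \<open>u\<close> and
    \<open>n\<close>. Hence \<open>R (Suc k)\<close> is available when the length of stage
    \<open>k\<close> is fixed.\<close>
  have "\<exists>R. \<forall>u\<in>G. \<forall>n. (\<exists>t. good M k R u n t) \<and> (\<exists>t. good N k R u n t)" for k
  proof -
    obtain R R' where R: "\<forall>u\<in>G. \<forall>n. \<exists>t. good M k R u n t" "\<forall>u\<in>G. \<forall>n. \<exists>t. good N k R' u n t"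
      using ex[OF M] ex[OF N] by metis
    have "(\<exists>t. good M k (max R R') u n t) \<and> (\<exists>t. good N k (max R R') u n t)" if "u \<in> G" for u n
      using R that mono by (meson max.cobounded1 max.cobounded2)
    then show ?thesis by blast
  qed
  then obtain R where R: "\<And>k u n. u \<in> G \<Longrightarrow> (\<exists>t. good M k (R k) u n t) \<and> (\<exists>t. good N k (R k) u n t)"
    by metis
  \<comment> \<open>Fixing the choices as functions of stage, word and length makes the construction
    depend on \<alpha> only through the entries already consumed.\<close>
  define f where "f k u n = (SOME t. good M k (R k) u n t)" for k u n
  define g where "g k u n = (SOME t. good N k (R k) u n t)" for k u n
  have f: "good M k (R k) u n (f k u n)" and g: "good N k (R k) u n (g k u n)" if "u \<in> G" for k u n
    unfolding f_def g_def using R[OF that] by (blast intro: someI_ex)+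
  obtain u0 where u0: "u0 \<in> G" using G by (auto simp: feeble_base_def)
  \<comment> \<open>The requested lengths are those demanded by \<open>pq\<close> and
    \<open>qp\<close> in \<open>frequency_analysis\<close>. The outer \<open>Suc\<close> in
    \<open>step\<close> also keeps every \<nu>-part nonempty.\<close>
  define half where "half k u = u @ f k u (Suc k * (length u + R k + R (Suc k) + 1))" for k u
  define step where "step m k u = half k u @ g k (half k u) (Suc (length (half k u) div Suc m))" for m k u
  define U where "U \<alpha> = rec_nat u0 (\<lambda>k. step (\<alpha> k) k)" for \<alpha>
  have U_simps: "U \<alpha> 0 = u0" "U \<alpha> (Suc k) = step (\<alpha> k) k (U \<alpha> k)" for \<alpha> k
    by (simp_all add: U_def)
  \<comment> \<open>The index is in range because every stage adds a letter;
    \<open>U \<alpha> (Suc n)\<close> reads exactly the entries of \<alpha> up to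
    \<open>n\<close>.\<close>
  define \<phi> where "\<phi> \<alpha> n = U \<alpha> (Suc n) ! n" for \<alpha> n
  have half_G: "half k u \<in> G" if "u \<in> G" for k u
    using f[OF that] unfolding half_def good_def by blast
  have step_G: "step m k u \<in> G" if "u \<in> G" for m k u
    using g[OF half_G[OF that]] unfolding step_def good_def by blast
  have U_G: "U \<alpha> k \<in> G" for \<alpha> k by (induction k) (simp_all add: U_simps u0 step_G)
  define V where "V \<alpha> k = half k (U \<alpha> k)" for \<alpha> k
  have V_G: "V \<alpha> k \<in> G" for \<alpha> k unfolding V_def by (rule half_G[OF U_G])
  define s where "s \<alpha> k = f k (U \<alpha> k) (Suc k * (length (U \<alpha> k) + R k + R (Suc k) + 1))" for \<alpha> k
  define t where "t \<alpha> k = g k (V \<alpha> k) (Suc (length (V \<alpha> k) div Suc (\<alpha> k)))" for \<alpha> k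
  have V: "V \<alpha> k = U \<alpha> k @ s \<alpha> k" for \<alpha> k by (simp add: V_def half_def s_def)
  have U: "U \<alpha> (Suc k) = V \<alpha> k @ t \<alpha> k" for \<alpha> k by (simp add: U_simps step_def V_def t_def)
  have s: "good M k (R k) (U \<alpha> k) (Suc k * (length (U \<alpha> k) + R k + R (Suc k) + 1)) (s \<alpha> k)" for \<alpha> k
    unfolding s_def by (rule f[OF U_G])
  have t: "good N k (R k) (V \<alpha> k) (Suc (length (V \<alpha> k) div Suc (\<alpha> k))) (t \<alpha> k)" for \<alpha> k
    unfolding t_def by (rule g[OF V_G])
  have UV_length: "length (U \<alpha> k) < length (U \<alpha> (Suc k))" for \<alpha> k
  proof -
    have "t \<alpha> k \<noteq> []" using t[of k \<alpha>] unfolding good_def by auto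
    then show ?thesis by (simp add: U V)
  qed
  have \<phi>_U: "\<phi> \<alpha> i = U \<alpha> k ! i" if "i < length (U \<alpha> k)" for \<alpha> k i
    unfolding \<phi>_def
  proof (rule prefix_limit[where k="\<lambda>k. length (U \<alpha> k)" and \<beta>="\<lambda>k. (!) (U \<alpha> k)"])
    show "U \<alpha> (Suc m) ! i = U \<alpha> m ! i" if "i < length (U \<alpha> m)" for m i
      using that by (simp add: U V nth_append)
  qed (use UV_length that in auto)
  have \<phi>_V: "\<phi> \<alpha> i = V \<alpha> k ! i" if "i < length (V \<alpha> k)" for \<alpha> k i
    using \<phi>_U[of i \<alpha> "Suc k"] that by (simp add: U nth_append)
  have "strict_mono (\<lambda>k. length (U \<alpha> k))" for \<alpha>
    using UV_length by (simp add: strict_mono_Suc_iff)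
  then have length_U: "k \<le> length (U \<alpha> k)" for \<alpha> k by (rule strict_mono_imp_increasing)
  have in_X: "\<phi> \<alpha> \<in> X" for \<alpha>
  proof (rule subshift_mem_if_prefixes[OF X])
    fix n
    have "U \<alpha> (Suc n) \<in> language X" using U_G G by (auto simp: feeble_base_def)
    then obtain z where z: "z \<in> X" "appears_at (U \<alpha> (Suc n)) z 0"
      by (auto simp: language_appears_at_0[OF X])
    have "appears_at (map (\<phi> \<alpha>) [0..<Suc n]) z 0"
      unfolding appears_at_def
    proof (intro allI impI)
      fix i assume "i < length (map (\<phi> \<alpha>) [0..<Suc n])"
      then have i: "i < Suc n" by simp
      then have "i < length (U \<alpha> (Suc n))" using length_U[of "Suc n" \<alpha>] by simp
      then show "z (0 + i) = map (\<phi> \<alpha>) [0..<Suc n] ! i"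
        using z(2) \<phi>_U[of i \<alpha> "Suc n"] i unfolding appears_at_def by (simp del: upt_Suc)
    qed
    then show "map (\<phi> \<alpha>) [0..<Suc n] \<in> language X"
      using z(1) by (auto simp: language_appears_at_0[OF X])
  qed
  have occ_U: "inner_occ w (\<phi> \<alpha>) n = inner_occ w ((!) (U \<alpha> k)) n" if "n \<le> length (U \<alpha> k)" for w n \<alpha> k
    using that by (intro inner_occ_cong \<phi>_U) simp
  have occ_V: "inner_occ w (\<phi> \<alpha>) n = inner_occ w ((!) (V \<alpha> k)) n" if "n \<le> length (V \<alpha> k)" for w n \<alpha> k
    using that by (intro inner_occ_cong \<phi>_V) simp
  have freq: "(filterlim \<alpha> at_top sequentially \<longrightarrow>
      (\<lambda>n. real (inner_occ w (\<phi> \<alpha>) n) / real n) \<longlonglongrightarrow> measure M (cylinder A w)) \<and>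
    (\<not> filterlim \<alpha> at_top sequentially \<longrightarrow> measure M (cylinder A w) \<noteq> measure N (cylinder A w) \<longrightarrow>
      \<not> convergent (\<lambda>n. real (inner_occ w (\<phi> \<alpha>) n) / real n))"
    if w: "w \<in> lists A" "w \<noteq> []" for \<alpha> w
  proof -
    define K0 where "K0 = to_nat_on (lists A) w"
    have wW: "w \<in> W k" if "k \<ge> K0" for k using w that by (simp add: W_def K0_def)
    note analysis = frequency_analysis[of "inner_occ w (\<phi> \<alpha>)" "measure M (cylinder A w)" K0
        "\<lambda>k. length (U \<alpha> k)" "\<lambda>k. length (V \<alpha> k)" R "measure N (cylinder A w)" \<alpha>]
    have a: "inner_occ w (\<phi> \<alpha>) n \<le> n" "inner_occ w (\<phi> \<alpha>) n \<le> inner_occ w (\<phi> \<alpha>) (n + j)"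
      "inner_occ w (\<phi> \<alpha>) (n + j) \<le> inner_occ w (\<phi> \<alpha>) n + j" for n j
      using w(2) by (auto intro: inner_occ_le inner_occ_mono inner_occ_add_le)
    have b: "0 \<le> measure M (cylinder A w)" "measure M (cylinder A w) \<le> 1"
      by (simp_all add: inv_measure_le_1[OF M])
    have c: "\<bar>real (inner_occ w (\<phi> \<alpha>) (length (U \<alpha> k) + j)) - inner_occ w (\<phi> \<alpha>) (length (U \<alpha> k))
        - measure M (cylinder A w) * j\<bar> \<le> 1 / Suc k * j + R k"
      if "k \<ge> K0" "length (U \<alpha> k) + j \<le> length (V \<alpha> k)" for k j
      using s[of k \<alpha>] wW[OF that(1)] that(2)
      unfolding good_def occ_V[OF that(2)] occ_U[OF order_refl] V by simp
    have d: "\<bar>real (inner_occ w (\<phi> \<alpha>) (length (V \<alpha> k) + j)) - inner_occ w (\<phi> \<alpha>) (length (V \<alpha> k))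
        - measure N (cylinder A w) * j\<bar> \<le> 1 / Suc k * j + R k"
      if "k \<ge> K0" "length (V \<alpha> k) + j \<le> length (U \<alpha> (Suc k))" for k j
      using t[of k \<alpha>] wW[OF that(1)] that(2)
      unfolding good_def occ_U[OF that(2)] occ_V[OF order_refl] U by simp
    have e: "length (U \<alpha> k) + Suc k * (length (U \<alpha> k) + R k + R (Suc k) + 1) \<le> length (V \<alpha> k)" for k
      using s[of k \<alpha>] unfolding good_def V by simp
    have f: "length (V \<alpha> k) + Suc (length (V \<alpha> k) div Suc (\<alpha> k)) \<le> length (U \<alpha> (Suc k))"
      "length (U \<alpha> (Suc k)) \<le> length (V \<alpha> k) + Suc (length (V \<alpha> k) div Suc (\<alpha> k)) + R k" for k
      using t[of k \<alpha>] unfolding good_def U by simp_all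
    show ?thesis using analysis[OF a b c d e f] by blast
  qed
  show thesis
  proof (rule that[of \<phi>])
    show "\<phi> \<beta> n = \<phi> \<alpha> n" if "\<And>i. i \<le> n \<Longrightarrow> \<beta> i = \<alpha> i" for \<alpha> \<beta> :: "nat \<Rightarrow> nat" and n
    proof -
      have "U \<beta> k = U \<alpha> k" if "k \<le> Suc n" for k
        using that \<open>\<And>i. i \<le> n \<Longrightarrow> \<beta> i = \<alpha> i\<close> by (induction k) (simp_all add: U_simps)
      then show ?thesis by (simp add: \<phi>_def)
    qed
  next
    fix \<alpha> :: "nat \<Rightarrow> nat" and w assume \<alpha>: "filterlim \<alpha> at_top sequentially" and w: "w \<in> lists A" "w \<noteq> []"
    show "(\<lambda>n. real (occurrences w (\<phi> \<alpha>) n) / real n) \<longlonglongrightarrow> measure M (cylinder A w)"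
      using freq[OF w, of \<alpha>] \<alpha> unfolding frequency_tendsto_iff[OF w(2)] by blast
  next
    fix \<alpha> :: "nat \<Rightarrow> nat" and w assume \<alpha>: "\<not> filterlim \<alpha> at_top sequentially" and w: "w \<in> lists A" "w \<noteq> []"
      and "measure M (cylinder A w) \<noteq> measure N (cylinder A w)"
    then show "\<not> convergent (\<lambda>n. real (occurrences w (\<phi> \<alpha>) n) / real n)"
      using freq[OF w, of \<alpha>] unfolding convergent_def frequency_tendsto_iff[OF w(2)] by blast
  qed (rule in_X)
qed

section \<open>Irregularity as divergence of frequencies\<close>

text \<open>The bounds keep a common value of the lower and upper limit finite, so equality in
  \<open>ereal\<close> yields a real limit.\<close>

lemma liminf_less_limsup_iff:
  fixes f :: "nat \<Rightarrow> real"
  assumes f: "\<And>n. 0 \<le> f n" "\<And>n. f n \<le> 1"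
  shows "liminf (\<lambda>n. ereal (f n)) < limsup (\<lambda>n. ereal (f n)) \<longleftrightarrow> \<not> convergent f"
proof
  assume "liminf (\<lambda>n. ereal (f n)) < limsup (\<lambda>n. ereal (f n))"
  then show "\<not> convergent f"
    by (metis convergent_def lim_ereal lim_imp_Liminf lim_imp_Limsup order.irrefl
        trivial_limit_sequentially)
next
  assume nc: "\<not> convergent f"
  show "liminf (\<lambda>n. ereal (f n)) < limsup (\<lambda>n. ereal (f n))"
  proof (rule ccontr)
    assume "\<not> ?thesis"
    then have eq: "limsup (\<lambda>n. ereal (f n)) = liminf (\<lambda>n. ereal (f n))"
      using Liminf_le_Limsup[of sequentially "\<lambda>n. ereal (f n)"] by simp
    have "0 \<le> liminf (\<lambda>n. ereal (f n))" by (rule Liminf_bounded) (simp add: f)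
    moreover have "limsup (\<lambda>n. ereal (f n)) \<le> 1"
      by (rule Limsup_bounded) (simp add: f flip: one_ereal_def)
    ultimately obtain l where "liminf (\<lambda>n. ereal (f n)) = ereal l"
      using eq by (cases "liminf (\<lambda>n. ereal (f n))") auto
    then have "(\<lambda>n. ereal (f n)) \<longlonglongrightarrow> ereal l"
      using eq by (intro Liminf_eq_Limsup) simp_all
    then have "f \<longlonglongrightarrow> l" by simp
    with nc show False by (auto simp: convergent_def)
  qed
qed

lemma occurrences_le: "occurrences w x N \<le> N"
proof -
  have "card {l. l < N \<and> appears_at w x l} \<le> card {..<N}" by (rule card_mono) auto
  then show ?thesis by (simp add: occurrences_def)
qed

lemma irregular_set_eq:
  fixes X :: "(nat \<Rightarrow> 'a) set"
  shows "irregular_set X = {x\<in>X. \<exists>w\<in>language X. \<not> convergent (\<lambda>N. real (occurrences w x N) / real N)}"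
proof -
  have "liminf (\<lambda>N. ereal (real (occurrences w x N) / real N))
      < limsup (\<lambda>N. ereal (real (occurrences w x N) / real N)) \<longleftrightarrow>
      \<not> convergent (\<lambda>N. real (occurrences w x N) / real N)" for w and x :: "nat \<Rightarrow> 'a"
    by (rule liminf_less_limsup_iff) (simp_all add: divide_le_eq occurrences_le)
  then show ?thesis by (simp add: irregular_set_def)
qed

lemma quasi_regular_set_eq:
  "quasi_regular_set X = {x\<in>X. \<forall>w\<in>language X. convergent (\<lambda>N. real (occurrences w x N) / real N)}"
  unfolding quasi_regular_set_def irregular_set_eq by blast

lemma generic_subset_quasi_regular:
  assumes "subshift A X"
  shows "generic_points A X M \<subseteq> quasi_regular_set X"
proof
  fix x assume x: "x \<in> generic_points A X M"
  have "convergent (\<lambda>N. real (occurrences w x N) / real N)" if "w \<in> language X" for w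
    using x language_in_lists[OF assms that] that
    by (auto simp: generic_points_def language_def convergent_def)
  then show "x \<in> quasi_regular_set X" using x by (auto simp: quasi_regular_set_eq generic_points_def)
qed

section \<open>Generic and quasi-regular points form sets of the third multiplicative class\<close>

lemma occurrences_cong:
  assumes "\<And>i. i < N + length w \<Longrightarrow> x i = y i"
  shows "occurrences w x N = occurrences w y N"
proof -
  have "{l. l < N \<and> appears_at w x l} = {l. l < N \<and> appears_at w y l}"
    using assms by (auto simp: appears_at_def)
  then show ?thesis by (simp add: occurrences_def)
qed

text \<open>A violation at \<open>n\<close> and \<open>m\<close> is visible in the first
  \<open>max n m + length w\<close> letters, so it persists nearby. Two indices are allowed in order
  to cover the Cauchy condition.\<close>

lemma closedin_occurrences:
  assumes "X \<subseteq> topspace (full_shift A)"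
  shows "closedin (subtopology (full_shift A) X)
    {x\<in>X. \<forall>n\<ge>N. \<forall>m\<ge>N. P n m (occurrences w x n) (occurrences w x m)}"
proof -
  let ?C = "{x\<in>X. \<forall>n\<ge>N. \<forall>m\<ge>N. P n m (occurrences w x n) (occurrences w x m)}"
  have "openin (subtopology (full_shift A) X) (X - ?C)"
    unfolding openin_subshift_iff[OF assms]
  proof (intro conjI ballI)
    fix x assume "x \<in> X - ?C"
    then obtain n m where nm: "n \<ge> N" "m \<ge> N" "\<not> P n m (occurrences w x n) (occurrences w x m)" by blast
    show "\<exists>k. \<forall>y\<in>X. (\<forall>i<k. y i = x i) \<longrightarrow> y \<in> X - ?C"
    proof (intro exI ballI impI)
      fix y assume y: "y \<in> X" "\<forall>i<max n m + length w. y i = x i"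
      then have "occurrences w y n = occurrences w x n" "occurrences w y m = occurrences w x m"
        by (auto intro!: occurrences_cong)
      then have "\<not> P n m (occurrences w y n) (occurrences w y m)" using nm(3) by simp
      then show "y \<in> X - ?C" using nm(1,2) y(1) by blast
    qed
  qed auto
  then show ?thesis using assms by (simp add: closedin_def Int_absorb1)
qed

lemma tendsto_iff_nat: "f \<longlonglongrightarrow> (c::real) \<longleftrightarrow> (\<forall>k. \<exists>N. \<forall>n\<ge>N. \<bar>f n - c\<bar> \<le> 1 / Suc k)"
proof
  assume f: "f \<longlonglongrightarrow> c"
  show "\<forall>k. \<exists>N. \<forall>n\<ge>N. \<bar>f n - c\<bar> \<le> 1 / Suc k"
  proof
    fix k
    obtain N where "\<forall>n\<ge>N. norm (f n - c) < 1 / Suc k"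
      using LIMSEQ_D[OF f, of "1 / Suc k"] by auto
    then show "\<exists>N. \<forall>n\<ge>N. \<bar>f n - c\<bar> \<le> 1 / Suc k" by (auto intro: less_imp_le)
  qed
next
  assume *: "\<forall>k. \<exists>N. \<forall>n\<ge>N. \<bar>f n - c\<bar> \<le> 1 / Suc k"
  show "f \<longlonglongrightarrow> c"
  proof (rule LIMSEQ_I)
    fix r :: real assume "r > 0"
    then obtain k where k: "1 / Suc k < r" by (metis nat_approx_posE)
    obtain N where "\<forall>n\<ge>N. \<bar>f n - c\<bar> \<le> 1 / Suc k" using * by blast
    then show "\<exists>no. \<forall>n\<ge>no. norm (f n - c) < r" using k by fastforce
  qed
qed

text \<open>The Cauchy form avoids naming the limit, which varies with the point and would bring in
  an uncountable union.\<close>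

lemma convergent_iff_nat:
  "convergent (f :: nat \<Rightarrow> real) \<longleftrightarrow> (\<forall>k. \<exists>N. \<forall>n\<ge>N. \<forall>m\<ge>N. \<bar>f n - f m\<bar> \<le> 1 / Suc k)"
proof
  assume "convergent f"
  then have f: "Cauchy f" by (simp add: Cauchy_convergent_iff)
  show "\<forall>k. \<exists>N. \<forall>n\<ge>N. \<forall>m\<ge>N. \<bar>f n - f m\<bar> \<le> 1 / Suc k"
  proof
    fix k
    obtain N where "\<forall>n\<ge>N. \<forall>m\<ge>N. norm (f n - f m) < 1 / Suc k"
      using CauchyD[OF f, of "1 / Suc k"] by auto
    then show "\<exists>N. \<forall>n\<ge>N. \<forall>m\<ge>N. \<bar>f n - f m\<bar> \<le> 1 / Suc k" by (auto intro: less_imp_le)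
  qed
next
  assume *: "\<forall>k. \<exists>N. \<forall>n\<ge>N. \<forall>m\<ge>N. \<bar>f n - f m\<bar> \<le> 1 / Suc k"
  have "Cauchy f"
  proof (rule CauchyI)
    fix r :: real assume "r > 0"
    then obtain k where k: "1 / Suc k < r" by (metis nat_approx_posE)
    obtain N where "\<forall>n\<ge>N. \<forall>m\<ge>N. \<bar>f n - f m\<bar> \<le> 1 / Suc k" using * by blast
    then show "\<exists>N. \<forall>m\<ge>N. \<forall>n\<ge>N. norm (f m - f n) < r" using k by fastforce
  qed
  then show "convergent f" by (simp add: Cauchy_convergent_iff)
qed

lemma generic_points_Pi_3:
  assumes cA: "countable A" and X: "X \<subseteq> topspace (full_shift A)"
  shows "generic_points A X M \<in> borel_Pi (subtopology (full_shift A) X) 3"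
proof (rule borel_Pi_3I)
  let ?I = "{w \<in> lists A. w \<noteq> []} \<times> (UNIV :: nat set)"
  let ?C = "\<lambda>(w, k) N. {x \<in> X. \<forall>n\<ge>N.
    \<bar>real (occurrences w x n) / n - measure M (cylinder A w)\<bar> \<le> 1 / Suc k}"
  show "countable ?I"
    using countable_lists[OF cA] by (intro countable_SIGMA) (auto intro: countable_subset)
  show "closedin (subtopology (full_shift A) X) (?C i N)" for i N
  proof -
    let ?P = "\<lambda>x n. \<bar>real (occurrences (fst i) x n) / n - measure M (cylinder A (fst i))\<bar> \<le> 1 / Suc (snd i)"
    \<comment> \<open>The index \<open>m\<close> is a dummy that gives the set the shape of
      \<open>closedin_occurrences\<close>; the range \<open>m \<ge> N\<close> is never
      empty.\<close>
    have "?C i N = {x \<in> X. \<forall>n\<ge>N. \<forall>m\<ge>N. ?P x n}" unfolding case_prod_unfold by blast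
    then show ?thesis
      using closedin_occurrences[OF X, of N "\<lambda>n m a b. \<bar>real a / n - measure M (cylinder A (fst i))\<bar> \<le> 1 / Suc (snd i)" "fst i"]
      by simp
  qed
  have "topspace (subtopology (full_shift A) X) = X" using X by (rule topspace_subtopology_subset)
  then show "generic_points A X M = {x \<in> topspace (subtopology (full_shift A) X). \<forall>i\<in>?I. \<exists>N. x \<in> ?C i N}"
    unfolding generic_points_def tendsto_iff_nat by auto
qed

lemma quasi_regular_set_Pi_3:
  assumes cA: "countable A" and X: "subshift A X"
  shows "quasi_regular_set X \<in> borel_Pi (subtopology (full_shift A) X) 3"
proof (rule borel_Pi_3I)
  let ?I = "language X \<times> (UNIV :: nat set)"
  let ?C = "\<lambda>(w, k) N. {x \<in> X. \<forall>n\<ge>N. \<forall>m\<ge>N.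
    \<bar>real (occurrences w x n) / n - real (occurrences w x m) / m\<bar> \<le> 1 / Suc k}"
  show "countable ?I"
    using countable_lists[OF cA] language_in_lists[OF X]
    by (intro countable_SIGMA) (auto intro: countable_subset)
  show "closedin (subtopology (full_shift A) X) (?C i N)" for i N
    using closedin_occurrences[OF subshift_subset[OF X], of N "\<lambda>n m a b. \<bar>real a / n - real b / m\<bar> \<le> 1 / Suc (snd i)" "fst i"]
    by (simp add: case_prod_unfold)
  have "topspace (subtopology (full_shift A) X) = X"
    using subshift_subset[OF X] by (rule topspace_subtopology_subset)
  then show "quasi_regular_set X = {x \<in> topspace (subtopology (full_shift A) X). \<forall>i\<in>?I. \<exists>N. x \<in> ?C i N}"
    unfolding quasi_regular_set_eq convergent_iff_nat by auto
qed

section \<open>Hardness of every set between the generic and the quasi-regular points\<close>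

lemma not_Sigma_3_between:
  fixes X :: "(nat \<Rightarrow> 'a) set"
  assumes cA: "countable A" and X: "subshift A X" and spec: "right_feeble_specification A X"
    and M: "invariant_prob_on A X M" and N: "invariant_prob_on A X N" and "M \<noteq> N"
    and B: "generic_points A X M \<subseteq> B" "B \<subseteq> quasi_regular_set X"
  shows "B \<notin> borel_Sigma (subtopology (full_shift A) X) 3"
proof
  let ?T = "subtopology (full_shift A) X"
  assume "B \<in> borel_Sigma ?T 3"
  then show False
  proof (rule borel_Sigma_3E)
    fix U :: "nat \<Rightarrow> nat \<Rightarrow> (nat \<Rightarrow> 'a) set"
    assume U: "\<And>n m. openin ?T (U n m)" and BU: "B = (\<Union>n. topspace ?T \<inter> (\<Inter>m. U n m))"
    obtain G where G: "feeble_base A X G" using right_feeble_specificationD[OF spec] by blast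
    obtain \<phi> :: "(nat \<Rightarrow> nat) \<Rightarrow> nat \<Rightarrow> 'a" where \<phi>: "\<And>\<alpha>. \<phi> \<alpha> \<in> X"
      and local: "\<And>\<alpha> \<beta> n. (\<And>i. i \<le> n \<Longrightarrow> \<beta> i = \<alpha> i) \<Longrightarrow> \<phi> \<beta> n = \<phi> \<alpha> n"
      and gen: "\<And>\<alpha> w. filterlim \<alpha> at_top sequentially \<Longrightarrow> w \<in> lists A \<Longrightarrow> w \<noteq> [] \<Longrightarrow>
         (\<lambda>n. real (occurrences w (\<phi> \<alpha>) n) / real n) \<longlonglongrightarrow> measure M (cylinder A w)"
      and irr: "\<And>\<alpha> w. \<not> filterlim \<alpha> at_top sequentially \<Longrightarrow> w \<in> lists A \<Longrightarrow> w \<noteq> [] \<Longrightarrow>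
         measure M (cylinder A w) \<noteq> measure N (cylinder A w) \<Longrightarrow>
         \<not> convergent (\<lambda>n. real (occurrences w (\<phi> \<alpha>) n) / real n)"
      using reduction_map[OF cA X G M N] by blast
    obtain w where w: "w \<in> language X" "measure M (cylinder A w) \<noteq> measure N (cylinder A w)"
      using invariant_measures_differ[OF cA X M N \<open>M \<noteq> N\<close>] by blast
    \<comment> \<open>Each inclusion for \<open>B\<close> serves one direction: the lower one puts
      generic images into \<open>B\<close>, the upper one keeps out images whose frequency of
      \<open>w\<close> diverges.\<close>
    have in_B: "\<phi> \<alpha> \<in> B \<longleftrightarrow> filterlim \<alpha> at_top sequentially" for \<alpha>
    proof
      assume "filterlim \<alpha> at_top sequentially"
      then have "\<phi> \<alpha> \<in> generic_points A X M" using gen \<phi> by (simp add: generic_points_def)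
      then show "\<phi> \<alpha> \<in> B" using B by blast
    next
      assume "\<phi> \<alpha> \<in> B"
      then have "convergent (\<lambda>n. real (occurrences w (\<phi> \<alpha>) n) / real n)"
        using B w(1) by (auto simp: quasi_regular_set_eq)
      then show "filterlim \<alpha> at_top sequentially"
        using irr[of \<alpha> w] w language_in_lists[OF X w(1)] by (auto simp: language_def)
    qed
    have "(\<Union>n. \<Inter>m. {\<alpha>. \<phi> \<alpha> \<in> U n m}) \<noteq> {\<alpha>. filterlim \<alpha> at_top sequentially}"
    proof (rule tendsto_infinity_not_Sigma3)
      fix n m \<alpha> assume "\<alpha> \<in> {\<alpha>. \<phi> \<alpha> \<in> U n m}"
      then have "\<phi> \<alpha> \<in> U n m" by simp
      moreover have "\<forall>x\<in>U n m. \<exists>k. \<forall>y\<in>X. (\<forall>i<k. y i = x i) \<longrightarrow> y \<in> U n m"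
        using U[of n m] unfolding openin_subshift_iff[OF subshift_subset[OF X]] by (rule conjunct2)
      ultimately obtain k where k: "\<forall>y\<in>X. (\<forall>i<k. y i = \<phi> \<alpha> i) \<longrightarrow> y \<in> U n m" by blast
      have "\<phi> \<beta> \<in> U n m" if "\<forall>i<k. \<beta> i = \<alpha> i" for \<beta>
      proof -
        have "\<phi> \<beta> i = \<phi> \<alpha> i" if "i < k" for i
          using \<open>\<forall>i<k. \<beta> i = \<alpha> i\<close> that by (intro local) simp
        then show ?thesis using k \<phi>[of \<beta>] by blast
      qed
      then show "\<exists>k. \<forall>\<beta>. (\<forall>i<k. \<beta> i = \<alpha> i) \<longrightarrow> \<beta> \<in> {\<alpha>. \<phi> \<alpha> \<in> U n m}" by blast
    qed
    moreover have "(\<Union>n. \<Inter>m. {\<alpha>. \<phi> \<alpha> \<in> U n m}) = {\<alpha>. \<phi> \<alpha> \<in> B}"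
    proof -
      have "\<phi> \<alpha> \<in> topspace ?T" for \<alpha>
        using \<phi> topspace_subtopology_subset[OF subshift_subset[OF X]] by simp
      then show ?thesis unfolding BU set_eq_iff mem_Collect_eq UN_iff INT_iff Int_iff by simp
    qed
    ultimately show False using in_B by simp
  qed
qed

theorem theorem6:
  fixes A :: "'a set" and X :: "(nat \<Rightarrow> 'a) set" and \<mu> :: "(nat \<Rightarrow> 'a) measure"
  assumes "countable A"
    and "subshift A X"
    and "right_feeble_specification A X"
    and "\<exists>\<mu>\<^sub>1 \<mu>\<^sub>2. invariant_prob_on A X \<mu>\<^sub>1 \<and> invariant_prob_on A X \<mu>\<^sub>2 \<and> \<mu>\<^sub>1 \<noteq> \<mu>\<^sub>2"
    and "invariant_prob_on A X \<mu>"
  shows "(\<forall>B \<in> sets (borel_of (subtopology (full_shift A) X)).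
            generic_points A X \<mu> \<subseteq> B \<and> B \<subseteq> quasi_regular_set X \<longrightarrow>
            Pi03_hard (subtopology (full_shift A) X) B \<and>
            (B \<in> borel_Pi (subtopology (full_shift A) X) 3 \<longrightarrow>
              Pi03_complete (subtopology (full_shift A) X) B)) \<and>
         Pi03_complete (subtopology (full_shift A) X) (generic_points A X \<mu>) \<and>
         Pi03_complete (subtopology (full_shift A) X) (quasi_regular_set X) \<and>
         Sigma03_complete (subtopology (full_shift A) X) (irregular_set X)"
proof -
  let ?T = "subtopology (full_shift A) X"
  \<comment> \<open>Of two distinct measures at least one differs from \<mu>.\<close>
  obtain \<nu> where \<nu>: "invariant_prob_on A X \<nu>" "\<mu> \<noteq> \<nu>" using assms(4) by metis
  have hard: "B \<notin> borel_Sigma ?T 3" if "generic_points A X \<mu> \<subseteq> B" "B \<subseteq> quasi_regular_set X" for B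
    using not_Sigma_3_between[OF assms(1-3,5) \<nu> that] .
  have sub: "generic_points A X \<mu> \<subseteq> quasi_regular_set X"
    by (rule generic_subset_quasi_regular[OF assms(2)])
  have topX: "topspace ?T = X"
    using subshift_subset[OF assms(2)] by (rule topspace_subtopology_subset)
  have gen: "Pi03_complete ?T (generic_points A X \<mu>)"
    using generic_points_Pi_3[OF assms(1) subshift_subset[OF assms(2)]] hard[OF order_refl sub]
    by (simp add: Pi03_complete_def)
  have quasi: "Pi03_complete ?T (quasi_regular_set X)"
    using quasi_regular_set_Pi_3[OF assms(1,2)] hard[OF sub order_refl]
    by (simp add: Pi03_complete_def)
  have "irregular_set X \<subseteq> X" by (auto simp: irregular_set_def)
  \<comment> \<open>Complements are taken in \<open>X\<close>, so a set is recovered from its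
    complement only if it lies in \<open>X\<close>. Passing between the irregular and the
    quasi-regular set needs this in both directions.\<close>
  have compl: "S \<in> borel_Sigma ?T 3 \<Longrightarrow> S \<subseteq> X" for S
    using openin_subset[of ?T] topX by (force elim!: borel_Sigma_3E)
  have "irregular_set X \<in> borel_Sigma ?T 3"
  proof -
    obtain S where "S \<in> borel_Sigma ?T 3" "X - irregular_set X = X - S"
      using quasi unfolding Pi03_complete_def borel_Pi_def topX quasi_regular_set_def by blast
    moreover from this have "irregular_set X = S" using compl \<open>irregular_set X \<subseteq> X\<close> by blast
    ultimately show ?thesis by simp
  qed
  moreover have "irregular_set X \<notin> borel_Pi ?T 3"
  proof
    assume "irregular_set X \<in> borel_Pi ?T 3"
    then obtain S where S: "S \<in> borel_Sigma ?T 3" "irregular_set X = X - S"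
      unfolding borel_Pi_def topX by blast
    then have "quasi_regular_set X = S" using compl unfolding quasi_regular_set_def by blast
    then show False using S(1) hard[OF sub order_refl] by simp
  qed
  ultimately have "Sigma03_complete ?T (irregular_set X)" by (simp add: Sigma03_complete_def)
  then show ?thesis using hard gen quasi by (auto simp: Pi03_hard_def Pi03_complete_def)
qed

end
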